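(* Let $m=m(n)$ and $s=s(n)$ be positive integers such that $m=o\!\left(\frac{s^2}{(\log n)^2}\right)$ as $n\to\infty$. Let $A$ be chosen uniformly at random from the family of all sets $A\subseteq[n]=\{1,\dots,n\}$ with $|A|=s$ and $|A+A|\le m$. Then there exists a sequence $\eta_n\to0$ such that, with probability tending to $1$ as $n\to\infty$, there is an arithmetic progression $P\subseteq\mathbb{Z}$ with $|P|\le m/2+\eta_n m$ and $|A\setminus P|\le \eta_n s$.
   Context: For $A\subseteq\mathbb{Z}$, $A+A=\{a_1+a_2:a_1,a_2\in A\}$. Logarithms are base $2$. The random set is only defined for $n$ such that the family is nonempty. *)

theory Defs
  imports "HOL-Probability.Probability" "HOL-Library.Landau_Symbols" "HOL-Library.Set_Algebras"
begin

text \<open>Arithmetic progressions are finite and nonempty, with nonzero common difference, so that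
  \<open>card P\<close> is the number of terms.\<close>

definition arith_prog :: "int set \<Rightarrow> bool" where
  "arith_prog P \<longleftrightarrow> (\<exists>a d k. d \<noteq> 0 \<and> 1 \<le> k \<and> P = {a + int i * d | i. i < k})"

definition small_doubling :: "nat \<Rightarrow> nat \<Rightarrow> nat \<Rightarrow> int set set" where
  "small_doubling n s m = {A. A \<subseteq> {1..int n} \<and> card A = s \<and> card (A + A) \<le> m}"

end

theory Submission imports Defs begin

text \<open>
  Containers. Let \<open>A\<close> have \<open>s\<close> elements and at most \<open>m\<close> sums. Fix \<open>T \<subseteq> A\<close> of size about \<open>\<surd>m\<close> and
  add elements of \<open>A\<close> to \<open>S\<close> as long as each of them contributes at least \<open>card T / 2\<close> new elements
  to \<open>S + T\<close>. This stops after \<open>O(\<surd>m)\<close> steps, and then \<open>A\<close> lies in the set of all \<open>x\<close> for which at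
  least half of \<open>x + T\<close> is in \<open>S + T\<close>, which has at most \<open>2m\<close> elements. Describing \<open>T\<close> and \<open>S\<close> costs
  \<open>O(\<surd>m log n) = o(s)\<close> bits, which is where the hypothesis on \<open>m\<close> enters. Inside a set of size
  \<open>O(m)\<close> a sublinear part of \<open>A\<close> can be specified for free, so one may reveal \<open>F \<subseteq> A\<close> with
  \<open>card F = o(s)\<close> such that \<open>D = F + F\<close> contains almost all sums of pairs from \<open>A\<close>. A
  Kleitman-Winston argument with boundedly many further elements gives a container \<open>B\<close> of almost all
  of \<open>A\<close> such that, for each \<open>x \<in> B\<close>, almost all of \<open>x + B\<close> lies in \<open>D\<close>, where \<open>card D \<le> m\<close>.

  Structure. If \<open>B\<close> has nearly \<open>m / 2\<close> elements \<open>b\<^sub>0 < b\<^sub>1 < \<dots>\<close>, then monotone lattice paths show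
  that \<open>b\<^sub>i + b\<^sub>j\<close> has rank close to \<open>i + j\<close> in \<open>D\<close>. Hence every short difference \<open>b\<^sub>q - b\<^sub>p\<close> is an
  almost-period of \<open>B\<close>, the short differences are closed under sums and differences, and so they are
  exactly the multiples of one number \<open>d\<close>. Counting makes \<open>B\<close> nearly an interval of a residue class
  modulo \<open>d\<close>.

  Counting. The sets \<open>A\<close> whose container is smaller by a constant factor are exponentially few
  compared with the \<open>s\<close>-subsets of an interval of length \<open>m / 2\<close>, all of which have small doubling.
\<close>

section \<open>Sets almost closed under addition into a small set\<close>

definition leaving :: "'a::ab_group_add set \<Rightarrow> 'a \<Rightarrow> 'a set" where
  "leaving B \<delta> = {x \<in> B. x + \<delta> \<notin> B}"

lemma card_not_leaving:
  assumes "finite B"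
  shows "card {x \<in> B. x + \<delta> \<in> B} = card B - card (leaving B \<delta>)"
proof -
  have "{x \<in> B. x + \<delta> \<in> B} = B - leaving B \<delta>" by (auto simp: leaving_def)
  then show ?thesis using assms by (simp add: card_Diff_subset leaving_def)
qed

lemma card_leaving_uminus:
  assumes "finite B"
  shows "card (leaving B (- \<delta>)) = card (leaving B \<delta>)"
proof -
  have "bij_betw (\<lambda>x. x + \<delta>) {x \<in> B. x + \<delta> \<in> B} {x \<in> B. x + (- \<delta>) \<in> B}"
    by (rule bij_betwI[where g = "\<lambda>x. x - \<delta>"]) auto
  then have "card B - card (leaving B (- \<delta>)) = card B - card (leaving B \<delta>)"
    using assms by (simp add: bij_betw_same_card flip: card_not_leaving)
  moreover have "card (leaving B \<epsilon>) \<le> card B" for \<epsilon>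
    using assms by (intro card_mono) (auto simp: leaving_def)
  ultimately show ?thesis by (metis diff_diff_cancel)
qed

lemma exists_leaving_neither:
  assumes "finite B" "card (leaving B \<delta>) + card (leaving B \<epsilon>) < card B"
  shows "\<exists>x\<in>B. x + \<delta> \<in> B \<and> x + \<epsilon> \<in> B"
proof (rule ccontr)
  assume "\<not> ?thesis"
  then have "B \<subseteq> leaving B \<delta> \<union> leaving B \<epsilon>" by (auto simp: leaving_def)
  moreover have "finite (leaving B \<delta> \<union> leaving B \<epsilon>)" using assms(1) by (simp add: leaving_def)
  ultimately have "card B \<le> card (leaving B \<delta> \<union> leaving B \<epsilon>)" by (rule card_mono[rotated])
  with assms(2) show False using card_Un_le[of "leaving B \<delta>" "leaving B \<epsilon>"] by linarith
qed

locale almost_closed_sums =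
  fixes b :: "nat \<Rightarrow> 'a::linordered_ab_group_add" and N :: nat and D :: "'a set" and \<mu> w :: nat
  assumes strict_mono_b: "strict_mono_on {..<N} b"
    and finite_D: "finite D"
    and card_missing: "i < N \<Longrightarrow> card {j \<in> {..<N}. b i + b j \<notin> D} \<le> \<mu>"
    and card_D_le: "card D + 4 * \<mu> + 2 \<le> 2 * N + w"
    and N_pos: "0 < N"
begin

lemma b_less_iff: "i < N \<Longrightarrow> j < N \<Longrightarrow> b i < b j \<longleftrightarrow> i < j"
  using strict_mono_on_less[OF strict_mono_b] by simp

lemma b_le_iff: "i < N \<Longrightarrow> j < N \<Longrightarrow> b i \<le> b j \<longleftrightarrow> i \<le> j"
  using strict_mono_on_less_eq[OF strict_mono_b] by simp

lemma inj_on_b: "inj_on b {..<N}"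
  using strict_mono_b by (rule strict_mono_on_imp_inj_on)

definition B :: "'a set" where
  "B = b ` {..<N}"

lemma finite_B: "finite B" and card_B: "card B = N"
  unfolding B_def by (simp_all add: card_image inj_on_b)

lemma B_bounds: "x \<in> B \<Longrightarrow> b 0 \<le> x" "x \<in> B \<Longrightarrow> x \<le> b (N - 1)"
  using N_pos by (auto simp: B_def b_le_iff)

lemma card_row_Diff:
  assumes "i < N" "I \<subseteq> {..<N}"
  shows "card ((\<lambda>j. b i + b j) ` I - D) \<le> \<mu>"
proof -
  have "(\<lambda>j. b i + b j) ` I - D \<subseteq> (\<lambda>j. b i + b j) ` {j \<in> {..<N}. b i + b j \<notin> D}"
    using assms(2) by auto
  then have "card ((\<lambda>j. b i + b j) ` I - D) \<le> card {j \<in> {..<N}. b i + b j \<notin> D}"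
    by (rule surj_card_le[rotated]) simp
  also have "\<dots> \<le> \<mu>" by (rule card_missing[OF assms(1)])
  finally show ?thesis .
qed

lemma card_row_Int:
  assumes "i < N" "I \<subseteq> {..<N}"
  shows "card I \<le> card ((\<lambda>j. b i + b j) ` I \<inter> D) + \<mu>"
proof -
  let ?row = "(\<lambda>j. b i + b j) ` I"
  have "inj_on (\<lambda>j. b i + b j) I"
    using inj_on_subset[OF inj_on_b assms(2)] by (auto simp: inj_on_def)
  then have "card I = card ?row" by (simp add: card_image)
  also have "\<dots> \<le> card (?row \<inter> D) + card (?row - D)"
    using card_Un_le[of "?row \<inter> D" "?row - D"] by (simp add: Int_Diff_Un)
  finally show ?thesis using card_row_Diff[OF assms] by linarith
qed

text \<open>The sums \<open>b 0 + b 0, \<dots>, b 0 + b j, b 1 + b j, \<dots>, b i + b j\<close> increase along a lattice path, so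
  \<open>b i + b j\<close> has rank at least about \<open>i + j\<close> in \<open>D\<close>; a path from \<open>(i, j)\<close> to
  \<open>(N - 1, N - 1)\<close> bounds the rank from above.\<close>

lemma card_D_atMost_ge:
  assumes "i < N" "j < N"
  shows "i + j + 1 \<le> card (D \<inter> {..b i + b j}) + 2 * \<mu>"
proof -
  let ?P = "(\<lambda>l. b 0 + b l) ` {..j} \<inter> D" and ?Q = "(\<lambda>l. b j + b l) ` {1..i} \<inter> D"
  have "card {..j} \<le> card ?P + \<mu>" by (rule card_row_Int) (use assms in auto)
  moreover have "card {1..i} \<le> card ?Q + \<mu>" by (rule card_row_Int) (use assms in auto)
  moreover have "card (?P \<union> ?Q) = card ?P + card ?Q"
  proof (rule card_Un_disjoint)
    have "b k + b 0 < b j + b l" if "k \<le> j" "l \<in> {1..i}" for k l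
      using that assms by (intro add_le_less_mono) (simp_all add: b_le_iff b_less_iff)
    then have "b 0 + b k \<noteq> b j + b l" if "k \<le> j" "l \<in> {1..i}" for k l
      using that by (metis add.commute less_irrefl)
    then show "?P \<inter> ?Q = {}" by blast
  qed auto
  moreover have "card (?P \<union> ?Q) \<le> card (D \<inter> {..b i + b j})"
  proof (rule card_mono)
    have "b 0 + b l \<le> b i + b j" if "l \<le> j" for l
      using that assms by (intro add_mono) (simp_all add: b_le_iff)
    moreover have "b j + b l \<le> b i + b j" if "l \<le> i" for l
      using that assms by (subst add.commute, intro add_right_mono) (simp add: b_le_iff)
    ultimately show "?P \<union> ?Q \<subseteq> D \<inter> {..b i + b j}" by auto
  qed (use finite_D in auto)
  ultimately show ?thesis by simp
qed

lemma card_D_atLeast_ge: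
  assumes "i < N" "j < N"
  shows "2 * N \<le> card (D \<inter> {b i + b j..}) + i + j + 1 + 2 * \<mu>"
proof -
  let ?P = "(\<lambda>l. b (N - 1) + b l) ` {j..<N} \<inter> D" and ?Q = "(\<lambda>l. b j + b l) ` {i..<N - 1} \<inter> D"
  have "card {j..<N} \<le> card ?P + \<mu>" by (rule card_row_Int) (use assms in auto)
  moreover have "card {i..<N - 1} \<le> card ?Q + \<mu>" by (rule card_row_Int) (use assms in auto)
  moreover have "card (?P \<union> ?Q) = card ?P + card ?Q"
  proof (rule card_Un_disjoint)
    have "b j + b l < b k + b (N - 1)" if "k \<in> {j..<N}" "l \<in> {i..<N - 1}" for k l
      using that assms by (intro add_le_less_mono) (auto simp: b_le_iff b_less_iff)
    then have "b (N - 1) + b k \<noteq> b j + b l" if "k \<in> {j..<N}" "l \<in> {i..<N - 1}" for k l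
      using that by (metis add.commute less_irrefl)
    then show "?P \<inter> ?Q = {}" by blast
  qed auto
  moreover have "card (?P \<union> ?Q) \<le> card (D \<inter> {b i + b j..})"
  proof (rule card_mono)
    have "b i + b j \<le> b (N - 1) + b l" if "l \<in> {j..<N}" for l
      using that assms by (intro add_mono) (auto simp: b_le_iff)
    moreover have "b i + b j \<le> b j + b l" if "l \<in> {i..<N - 1}" for l
      using that assms by (subst add.commute, intro add_left_mono) (auto simp: b_le_iff)
    ultimately show "?P \<union> ?Q \<subseteq> D \<inter> {b i + b j..}" by auto
  qed (use finite_D in auto)
  ultimately show ?thesis using assms by (simp; arith)
qed

lemma two_N_le_card_D: "2 * N \<le> card D + 2 * \<mu> + 1"
proof -
  have "card (D \<inter> {..b (N - 1) + b (N - 1)}) \<le> card D"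
    by (rule card_mono) (use finite_D in auto)
  with card_D_atMost_ge[of "N - 1" "N - 1"] N_pos show ?thesis by auto
qed

lemma missing_le_width: "2 * \<mu> + 1 \<le> w"
  using two_N_le_card_D card_D_le by simp

lemma sum_less:
  assumes "i < N" "j < N" "k < N" "l < N" "i + j + w \<le> k + l"
  shows "b i + b j < b k + b l"
proof (rule ccontr)
  assume "\<not> ?thesis"
  then have le: "b k + b l \<le> b i + b j" by simp
  let ?P = "D \<inter> {..b k + b l}" and ?Q = "D \<inter> {b i + b j..}"
  have "card ?P + card ?Q = card (?P \<union> ?Q) + card (?P \<inter> ?Q)"
    using finite_D by (intro card_Un_Int) auto
  also have "card (?P \<union> ?Q) \<le> card D"
    by (rule card_mono) (use finite_D in auto)
  also have "card (?P \<inter> ?Q) \<le> card {b k + b l}"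
    by (rule card_mono) (use le in auto)
  finally have "card ?P + card ?Q \<le> card D + 1" by simp
  with card_D_atMost_ge[OF assms(3,4)] card_D_atLeast_ge[OF assms(1,2)] card_D_le assms(5)
  show False by linarith
qed

lemma card_D_between_le:
  assumes "p < q" "q < N"
  shows "card (D \<inter> {b 0 + b p..b (N - 1) + b q}) \<le> N + (q - p) + w"
proof -
  let ?lo = "b 0 + b p" and ?hi = "b (N - 1) + b q"
  have "?lo \<le> ?hi" using assms by (intro add_mono) (simp_all add: b_le_iff)
  then have "D = D \<inter> {..<?lo} \<union> D \<inter> {?lo..?hi} \<union> D \<inter> {?hi<..}" by auto
  moreover have "card (D \<inter> {..<?lo} \<union> D \<inter> {?lo..?hi} \<union> D \<inter> {?hi<..})
      = card (D \<inter> {..<?lo}) + card (D \<inter> {?lo..?hi}) + card (D \<inter> {?hi<..})"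
    using finite_D \<open>?lo \<le> ?hi\<close> by (subst card_Un_disjoint; auto)+
  moreover have "card (D \<inter> {..?lo}) \<le> card (D \<inter> {..<?lo}) + 1"
    using card_insert_le_m1 card_mono[of "insert ?lo (D \<inter> {..<?lo})" "D \<inter> {..?lo}"] finite_D
    by (fastforce simp: card_insert_if split: if_splits)
  moreover have "card (D \<inter> {?hi..}) \<le> card (D \<inter> {?hi<..}) + 1"
    using card_mono[of "insert ?hi (D \<inter> {?hi<..})" "D \<inter> {?hi..}"] finite_D
    by (fastforce simp: card_insert_if split: if_splits)
  ultimately show ?thesis
    using card_D_atMost_ge[of 0 p] card_D_atLeast_ge[of "N - 1" q] card_D_le assms by simp
qed

lemma card_two_translates_le:
  assumes "p < q" "q < N"
  shows "card ((+) (b p) ` B \<union> (+) (b q) ` B) \<le> N + (q - p) + 2 * w"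
proof -
  let ?U = "(+) (b p) ` B" and ?V = "(+) (b q) ` B" and ?I = "{b 0 + b p..b (N - 1) + b q}"
  have p_less_N: "p < N" using assms by simp
  have "b p \<le> b q" using assms by (simp add: b_le_iff)
  have "b r + x \<in> ?I" if "x \<in> B" "r \<in> {p, q}" for x r
    using that B_bounds[OF that(1)] \<open>b p \<le> b q\<close>
    by (auto simp: add.commute[of "b r"] intro!: add_mono)
  then have "?U \<union> ?V \<subseteq> D \<inter> ?I \<union> (?U - D) \<union> (?V - D)" by blast
  then have "card (?U \<union> ?V) \<le> card (D \<inter> ?I \<union> (?U - D) \<union> (?V - D))"
    by (rule card_mono[rotated]) (use finite_B finite_D in auto)
  also have "\<dots> \<le> card (D \<inter> ?I) + card (?U - D) + card (?V - D)"
    by (meson add_mono card_Un_le le_trans order_refl)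
  also have "\<dots> \<le> card (D \<inter> ?I) + 2 * \<mu>"
    using card_row_Diff[OF p_less_N, of "{..<N}"] card_row_Diff[OF assms(2), of "{..<N}"]
    by (simp add: B_def image_image)
  finally show ?thesis using card_D_between_le[OF assms] missing_le_width by linarith
qed

lemma card_leaving_diff_le:
  assumes "p < q" "q < N"
  shows "card (leaving B (b q - b p)) \<le> (q - p) + 2 * w"
proof -
  let ?U = "(+) (b p) ` B" and ?V = "(+) (b q) ` B"
  have "(+) (b p) ` leaving B (- (b q - b p)) = ?U - ?V"
    by (force simp: leaving_def image_iff algebra_simps)
  then have "card (leaving B (b q - b p)) = card (?U - ?V)"
    by (metis card_image card_leaving_uminus finite_B inj_on_add)
  moreover have "card (?U \<union> ?V) = card (?U - ?V) + card ?V"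
    using card_Un_disjoint[of "?U - ?V" ?V] finite_B by (simp add: Diff_disjoint Int_commute)
  moreover have "card ?V = N" by (simp add: card_image card_B)
  ultimately show ?thesis using card_two_translates_le[OF assms] by linarith
qed

end

locale almost_closed_sums_short_diffs = almost_closed_sums +
  fixes H :: nat
  assumes w_less_H: "w < H" and H_less: "2 * (H + 2 * w) < N"
begin

definition min_spread :: 'a where
  "min_spread = Min ((\<lambda>p. b (p + H) - b p) ` {..<N - H})"

definition short_diffs :: "'a set" where
  "short_diffs = {\<delta>. 0 < \<delta> \<and> \<delta> \<le> min_spread \<and> (\<exists>x\<in>B. x + \<delta> \<in> B)}"

lemma H_less_N: "H < N"
  using H_less by simp

lemma min_spread_le: "p + H < N \<Longrightarrow> min_spread \<le> b (p + H) - b p"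
  unfolding min_spread_def by (intro Min_le) auto

lemma obtain_min_spread:
  obtains p where "p + H < N" "min_spread = b (p + H) - b p"
proof -
  have "min_spread \<in> (\<lambda>p. b (p + H) - b p) ` {..<N - H}"
    unfolding min_spread_def using H_less_N by (intro Min_in) (auto simp: lessThan_empty_iff)
  then obtain p where "p < N - H" "min_spread = b (p + H) - b p" by auto
  then show thesis by (intro that[of p]) auto
qed

lemma index_le_of_diff_le:
  assumes "q < N" "b q - b p \<le> min_spread"
  shows "q \<le> p + H"
proof (rule ccontr)
  assume "\<not> ?thesis"
  then have "min_spread \<le> b (p + H) - b p" "b (p + H) < b q"
    using assms(1) by (simp_all add: min_spread_le b_less_iff)
  with assms(2) show False by (simp add: algebra_simps)
qed

lemma diff_le_min_spread:
  assumes "i < N" "j < N" "j + w \<le> i + H"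
  shows "b j - b i \<le> min_spread"
proof -
  obtain p where p_attains: "p + H < N" "min_spread = b (p + H) - b p" by (rule obtain_min_spread)
  have "b j + b p < b i + b (p + H)" by (rule sum_less) (use p_attains assms in auto)
  then show ?thesis unfolding p_attains(2) by (simp add: algebra_simps)
qed

lemma short_diffsE:
  assumes "\<delta> \<in> short_diffs"
  obtains p q where "p < q" "q < N" "q \<le> p + H" "\<delta> = b q - b p"
proof -
  obtain x where x_mem: "x \<in> B" "x + \<delta> \<in> B" "0 < \<delta>" "\<delta> \<le> min_spread"
    using assms by (auto simp: short_diffs_def)
  then obtain p q where pq_indices: "p < N" "q < N" "x = b p" "x + \<delta> = b q" by (auto simp: B_def)
  then have "\<delta> = b q - b p" by (simp add: algebra_simps)
  moreover from this have "p < q" using x_mem(3) b_less_iff[OF pq_indices(1,2)] by simp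
  ultimately show thesis using that index_le_of_diff_le[of q p] pq_indices x_mem(4) by simp
qed

lemma finite_short_diffs: "finite short_diffs"
proof (rule finite_subset)
  show "short_diffs \<subseteq> (\<lambda>(p, q). b q - b p) ` ({..<N} \<times> {..<N})"
    by (force elim!: short_diffsE)
qed auto

lemma card_leaving_short_diff_le:
  assumes "\<delta> \<in> short_diffs"
  shows "card (leaving B \<delta>) \<le> H + 2 * w"
  using assms card_leaving_diff_le by (force elim!: short_diffsE)

lemma short_diffs_add:
  assumes "\<delta> \<in> short_diffs" "\<epsilon> \<in> short_diffs" "\<delta> + \<epsilon> \<le> min_spread"
  shows "\<delta> + \<epsilon> \<in> short_diffs"
proof -
  have "card (leaving B (- \<delta>)) + card (leaving B \<epsilon>) < card B"
    using card_leaving_short_diff_le[OF assms(1)] card_leaving_short_diff_le[OF assms(2)] H_less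
    by (simp add: card_leaving_uminus finite_B card_B)
  then obtain x where "x - \<delta> \<in> B" "x + \<epsilon> \<in> B"
    using exists_leaving_neither[OF finite_B, of "- \<delta>" \<epsilon>] by auto
  moreover have "x - \<delta> + (\<delta> + \<epsilon>) = x + \<epsilon>" by simp
  ultimately have "\<exists>y\<in>B. y + (\<delta> + \<epsilon>) \<in> B" by metis
  moreover have "0 < \<delta> + \<epsilon>" using assms(1,2) by (simp add: short_diffs_def add_pos_pos)
  ultimately show ?thesis using assms(3) by (simp add: short_diffs_def)
qed

lemma short_diffs_diff:
  assumes "\<delta> \<in> short_diffs" "\<epsilon> \<in> short_diffs" "\<epsilon> < \<delta>"
  shows "\<delta> - \<epsilon> \<in> short_diffs"
proof -
  have "card (leaving B \<delta>) + card (leaving B \<epsilon>) < card B"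
    using card_leaving_short_diff_le[OF assms(1)] card_leaving_short_diff_le[OF assms(2)] H_less
    by (simp add: card_B)
  then obtain x where "x + \<delta> \<in> B" "x + \<epsilon> \<in> B"
    using exists_leaving_neither[OF finite_B, of \<delta> \<epsilon>] by auto
  moreover have "x + \<epsilon> + (\<delta> - \<epsilon>) = x + \<delta>" by simp
  ultimately have "\<exists>y\<in>B. y + (\<delta> - \<epsilon>) \<in> B" by metis
  moreover have "\<delta> - \<epsilon> \<le> min_spread"
    using assms(1,2) by (auto simp: short_diffs_def intro: order_trans[of _ \<delta>])
  ultimately show ?thesis using assms(3) by (simp add: short_diffs_def)
qed

lemma consecutive_diff_short:
  assumes "Suc i < N"
  shows "b (Suc i) - b i \<in> short_diffs"
proof -
  have "b (Suc i) - b i \<le> min_spread"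
    by (rule diff_le_min_spread) (use assms w_less_H in auto)
  moreover have "0 < b (Suc i) - b i" using assms by (simp add: b_less_iff)
  moreover have "b i \<in> B" "b i + (b (Suc i) - b i) \<in> B"
    using assms by (simp_all add: B_def)
  ultimately show ?thesis unfolding short_diffs_def by blast
qed

lemma card_short_diffs_mult_le: "card short_diffs * (N - (H + 2 * w)) \<le> N * H"
proof -
  have "card short_diffs * (N - (H + 2 * w)) = (\<Sum>\<delta>\<in>short_diffs. N - (H + 2 * w))" by simp
  also have "\<dots> \<le> (\<Sum>\<delta>\<in>short_diffs. card {x \<in> B. x + \<delta> \<in> B})"
    using card_leaving_short_diff_le
    by (intro sum_mono) (simp add: card_not_leaving finite_B card_B diff_le_mono2)
  also have "\<dots> = (\<Sum>x\<in>B. card {\<delta> \<in> short_diffs. x + \<delta> \<in> B})"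
    by (rule sum_multicount_gen) (simp_all add: finite_B finite_short_diffs)
  also have "\<dots> \<le> (\<Sum>x\<in>B. H)"
  proof (rule sum_mono)
    fix x assume "x \<in> B"
    then obtain p where p_index: "p < N" "x = b p" by (auto simp: B_def)
    have "(+) x ` {\<delta> \<in> short_diffs. x + \<delta> \<in> B} \<subseteq> b ` {p<..p + H}"
    proof (rule image_subsetI)
      fix \<delta> assume "\<delta> \<in> {\<delta> \<in> short_diffs. x + \<delta> \<in> B}"
      then obtain q where q_index: "q < N" "x + \<delta> = b q" "0 < \<delta>" "\<delta> \<le> min_spread"
        by (auto simp: B_def short_diffs_def)
      then have "b p < b q" "b q - b p \<le> min_spread"
        using p_index(2) by (simp_all add: less_add_same_cancel1 flip: q_index(2))
      then show "x + \<delta> \<in> b ` {p<..p + H}"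
        using p_index q_index index_le_of_diff_le[of q p] by (simp add: b_less_iff)
    qed
    then have "card ((+) x ` {\<delta> \<in> short_diffs. x + \<delta> \<in> B}) \<le> card {p<..p + H}"
      by (rule surj_card_le[rotated]) simp
    then show "card {\<delta> \<in> short_diffs. x + \<delta> \<in> B} \<le> H" by (simp add: card_image)
  qed
  finally show ?thesis by (simp add: card_B)
qed

end

lemma obtain_multiples_of_closed:
  fixes R :: "int set" and G :: int
  assumes "R \<subseteq> {0<..G}" "R \<noteq> {}"
    and add: "\<And>\<delta> \<epsilon>. \<lbrakk>\<delta> \<in> R; \<epsilon> \<in> R; \<delta> + \<epsilon> \<le> G\<rbrakk> \<Longrightarrow> \<delta> + \<epsilon> \<in> R"
    and diff: "\<And>\<delta> \<epsilon>. \<lbrakk>\<delta> \<in> R; \<epsilon> \<in> R; \<epsilon> < \<delta>\<rbrakk> \<Longrightarrow> \<delta> - \<epsilon> \<in> R"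
  obtains d where "0 < d" "R = {\<delta> \<in> {0<..G}. d dvd \<delta>}"
proof
  define d where "d = Min R"
  have "finite R" using assms(1) by (rule finite_subset) simp
  then have d_least: "d \<in> R" "\<And>\<delta>. \<delta> \<in> R \<Longrightarrow> d \<le> \<delta>" using assms(2) by (simp_all add: d_def)
  show "0 < d" using d_least(1) assms(1) by auto
  have multiple: "int (Suc k) * d \<in> R" if "int (Suc k) * d \<le> G" for k
    using that
  proof (induction k)
    case (Suc k)
    have "int (Suc k) * d + d \<in> R"
      using Suc d_least(1) \<open>0 < d\<close> by (intro add) (auto simp: algebra_simps)
    then show ?case by (simp add: algebra_simps)
  qed (use d_least(1) in simp)
  have "d dvd \<delta>" if "\<delta> \<in> R" for \<delta>
    using that
  proof (induction "nat \<delta>" arbitrary: \<delta> rule: less_induct)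
    case less
    show ?case
    proof (cases "\<delta> = d")
      case False
      with d_least(2)[OF less.prems] have "d < \<delta>" by simp
      then have "d dvd \<delta> - d"
        using diff[OF less.prems d_least(1)] \<open>0 < d\<close> by (intro less.hyps) auto
      then show ?thesis by (metis dvd_add_triv_right_iff diff_add_cancel)
    qed simp
  qed
  moreover have "\<delta> \<in> R" if \<delta>: "0 < \<delta>" "\<delta> \<le> G" "d dvd \<delta>" for \<delta>
  proof -
    obtain k where k_eq: "\<delta> = k * d" using \<delta>(3) by (metis dvdE mult.commute)
    then have "0 < k" using \<delta>(1) \<open>0 < d\<close> by (simp add: zero_less_mult_iff)
    then have "k = int (Suc (nat k - 1))" by simp
    then show ?thesis using multiple \<delta>(2) k_eq by metis
  qed
  ultimately show "R = {\<delta> \<in> {0<..G}. d dvd \<delta>}" using assms(1) by auto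
qed

lemma residue_class_interval_eq_image:
  fixes a d :: int
  assumes "0 < d"
  shows "{x \<in> {a..a + int n * d}. d dvd x - a} = (\<lambda>i. a + int i * d) ` {..n}"
proof (intro equalityI subsetI)
  fix x assume x_mem: "x \<in> {x \<in> {a..a + int n * d}. d dvd x - a}"
  then obtain t where t_eq: "x - a = d * t" by (auto elim: dvdE)
  with x_mem assms have "0 \<le> t" "t \<le> int n" by (auto simp: algebra_simps zero_le_mult_iff)
  then show "x \<in> (\<lambda>i. a + int i * d) ` {..n}"
    using t_eq by (intro image_eqI[of _ _ "nat t"]) (auto simp: algebra_simps)
qed (use assms in \<open>auto intro: mult_right_mono\<close>)

lemma arith_prog_residue_class_interval:
  fixes a d :: int
  assumes "0 < d"
  shows "arith_prog {x \<in> {a..a + int n * d}. d dvd x - a}"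
  unfolding residue_class_interval_eq_image[OF assms] arith_prog_def
  using assms by (intro exI[of _ a] exI[of _ d] exI[of _ "Suc n"]) auto

lemma card_residue_class_interval:
  fixes a d :: int
  assumes "0 < d"
  shows "card {x \<in> {a..a + int n * d}. d dvd x - a} = n + 1"
  unfolding residue_class_interval_eq_image[OF assms]
  using assms by (simp add: card_image inj_on_def)

locale almost_closed_int_sums = almost_closed_sums_short_diffs b N D \<mu> w H
  for b :: "nat \<Rightarrow> int" and N D \<mu> w H
begin

lemma obtain_common_difference:
  obtains d where "0 < d" "min_spread < int (card short_diffs + 1) * d" "\<And>x. x \<in> B \<Longrightarrow> d dvd x - b 0"
proof -
  have "short_diffs \<subseteq> {0<..min_spread}" by (auto simp: short_diffs_def)
  moreover have "short_diffs \<noteq> {}" using consecutive_diff_short[of 0] H_less_N w_less_H by auto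
  ultimately obtain d where d_multiples: "0 < d" "short_diffs = {\<delta> \<in> {0<..min_spread}. d dvd \<delta>}"
    by (rule obtain_multiples_of_closed) (auto intro: short_diffs_add short_diffs_diff)
  have "d dvd b i - b 0" if "i < N" for i
    using that
  proof (induction i)
    case (Suc i)
    then have "d dvd (b (Suc i) - b i) + (b i - b 0)"
      using d_multiples(2) consecutive_diff_short[of i] by (intro dvd_add) auto
    then show ?case by simp
  qed simp
  moreover have "min_spread < int (card short_diffs + 1) * d"
  proof (rule ccontr)
    assume "\<not> ?thesis"
    then have all_multiples_le: "int (card short_diffs + 1) * d \<le> min_spread"
      by (simp only: not_less)
    have "(\<lambda>k. int k * d) ` {1..card short_diffs + 1} \<subseteq> short_diffs"
    proof (rule image_subsetI)
      fix k assume k_mem: "k \<in> {1..card short_diffs + 1}"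
      then have "int k * d \<le> int (card short_diffs + 1) * d"
        using d_multiples(1) by (intro mult_right_mono) auto
      also have "\<dots> \<le> min_spread" by (rule all_multiples_le)
      finally show "int k * d \<in> short_diffs" using k_mem d_multiples by simp
    qed
    then have "card ((\<lambda>k. int k * d) ` {1..card short_diffs + 1}) \<le> card short_diffs"
      by (rule card_mono[OF finite_short_diffs])
    then show False using d_multiples(1) by (simp add: card_image inj_on_def)
  qed
  ultimately show thesis using d_multiples(1) that by (auto simp: B_def)
qed

lemma span_le:
  assumes "j < N" "j \<le> k * (H - w)"
  shows "b j - b 0 \<le> int k * min_spread"
  using assms
proof (induction k arbitrary: j)
  case (Suc k)
  let ?i = "j - (H - w)"
  have "b j - b ?i \<le> min_spread"
    by (rule diff_le_min_spread) (use Suc.prems w_less_H in auto)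
  moreover have "b ?i - b 0 \<le> int k * min_spread" by (rule Suc.IH) (use Suc.prems in auto)
  ultimately show ?case by (simp add: algebra_simps)
qed simp

lemma subset_arith_prog:
  assumes "N \<le> J * (H - w)"
  shows "\<exists>P. arith_prog P \<and> B \<subseteq> P \<and> card P = J * (card short_diffs + 1) + 1"
proof -
  let ?K = "card short_diffs"
  obtain d where common_difference: "0 < d" "min_spread < int (?K + 1) * d"
    "\<And>x. x \<in> B \<Longrightarrow> d dvd x - b 0"
    using obtain_common_difference by blast
  let ?P = "{x \<in> {b 0..b 0 + int (J * (?K + 1)) * d}. d dvd x - b 0}"
  have "b (N - 1) - b 0 \<le> int J * min_spread"
    by (rule span_le) (use assms N_pos in auto)
  also have "\<dots> \<le> int J * (int (?K + 1) * d)"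
    using common_difference(2) by (intro mult_left_mono) auto
  finally have "b (N - 1) \<le> b 0 + int (J * (?K + 1)) * d"
    by (simp only: of_nat_mult mult.assoc diff_le_eq add.commute)
  then have "B \<subseteq> ?P" using B_bounds common_difference(3) by fastforce
  then show ?thesis
    using arith_prog_residue_class_interval[OF common_difference(1)]
      card_residue_class_interval[OF common_difference(1)]
    by blast
qed

end

lemma obtain_arith_prog_superset:
  fixes B D :: "int set"
  assumes "finite B" "finite D"
    and missing: "\<And>x. x \<in> B \<Longrightarrow> card {y \<in> B. x + y \<notin> D} \<le> \<mu>"
    and "card D + 4 * \<mu> + 2 \<le> 2 * card B + w" "w < H" "2 * (H + 2 * w) < card B"
      "card B \<le> J * (H - w)"
  obtains P K where "arith_prog P" "B \<subseteq> P" "card P = J * (K + 1) + 1"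
    "K * (card B - (H + 2 * w)) \<le> card B * H" "2 * card B \<le> card D + 2 * \<mu> + 1"
proof -
  let ?b = "(!) (sorted_list_of_set B)" and ?N = "card B"
  have "strict_mono_on {..<?N} ?b"
    by (intro strict_mono_onI sorted_wrt_nth_less[OF strict_sorted_list_of_set]) auto
  then have inj: "inj_on ?b {..<?N}" by (rule strict_mono_on_imp_inj_on)
  have image: "?b ` {..<?N} = B"
    using assms(1) nth_image[of ?N "sorted_list_of_set B"] by (simp add: atLeast0LessThan)
  interpret almost_closed_int_sums ?b ?N D \<mu> w H
  proof
    show "card {j \<in> {..<?N}. ?b i + ?b j \<notin> D} \<le> \<mu>" if "i < ?N" for i
    proof -
      have "?b ` {j \<in> {..<?N}. ?b i + ?b j \<notin> D} \<subseteq> {y \<in> B. ?b i + y \<notin> D}" using image by auto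
      then have "card {j \<in> {..<?N}. ?b i + ?b j \<notin> D} \<le> card {y \<in> B. ?b i + y \<notin> D}"
        by (intro card_inj_on_le[of ?b] inj_on_subset[OF inj]) (use assms(1) in auto)
      also have "\<dots> \<le> \<mu>" using that image by (intro missing) auto
      finally show ?thesis .
    qed
  qed (use assms \<open>strict_mono_on {..<?N} ?b\<close> in auto)
  have "almost_closed_sums.B ?b ?N = B" using image by (simp add: B_def)
  then show thesis
    using subset_arith_prog[OF assms(7)] card_short_diffs_mult_le two_N_le_card_D that by metis
qed

lemma power2_le_mult:
  fixes x c :: real
  assumes "0 \<le> x" "x \<le> c"
  shows "x\<^sup>2 \<le> c * x"
  using mult_right_mono[OF assms(2,1)] by (simp add: power2_eq_square)

lemma arith_prog_length_le:
  fixes \<theta> :: real and N H J K w :: nat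
  assumes \<theta>_bounds: "0 < \<theta>" "\<theta> \<le> 1 / 100" and N_large: "3 \<le> \<theta>\<^sup>2 * N" and w_le: "w \<le> \<theta>\<^sup>2 * N"
    and H_bounds: "\<theta> * N \<le> H" "H \<le> \<theta> * N + 1"
    and J_bound: "J \<le> N / (real H - real w) + 1"
    and K_mult_le: "K * (real N - (real H + 2 * real w)) \<le> N * H"
  shows "J * (real K + 1) + 1 \<le> (1 + 8 * \<theta>) * N"
proof -
  have \<theta>_square_le: "\<theta>\<^sup>2 \<le> \<theta> / 100"
    using \<theta>_bounds power2_le_mult[of \<theta> "1 / 100"] by simp
  have \<theta>_square_N_le: "100 * (\<theta>\<^sup>2 * N) \<le> \<theta> * N"
    using mult_right_mono[OF \<theta>_square_le, of "real N"] by simp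
  have N_pos: "0 < real N" using N_large by (cases "N = 0") auto
  have J_le: "\<theta> * J \<le> 1 + 3 * \<theta>"
  proof -
    have "\<theta> * N * (1 - \<theta>) \<le> real H - real w"
      using H_bounds w_le by (simp add: algebra_simps power2_eq_square)
    then have "N / (real H - real w) \<le> N / (\<theta> * N * (1 - \<theta>))"
      using \<theta>_bounds N_pos by (intro frac_le mult_pos_pos) auto
    with J_bound have "J \<le> 1 / (\<theta> * (1 - \<theta>)) + 1" using N_pos by simp
    then have "\<theta> * J \<le> \<theta> * (1 / (\<theta> * (1 - \<theta>)) + 1)" using \<theta>_bounds by (intro mult_left_mono) auto
    also have "\<dots> = 1 / (1 - \<theta>) + \<theta>" using \<theta>_bounds by (simp add: field_simps)
    also have "1 / (1 - \<theta>) \<le> 1 + 2 * \<theta>"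
      using \<theta>_bounds \<theta>_square_le by (simp add: field_simps power2_eq_square)
    finally show ?thesis by simp
  qed
  have K_le: "real K + 1 \<le> \<theta> * N * (1 + 4 * \<theta>)"
  proof -
    have "(1 - 2 * \<theta>) * N \<le> real N - (real H + 2 * real w)"
      using H_bounds w_le N_large \<theta>_square_N_le by (simp add: algebra_simps)
    then have "K * ((1 - 2 * \<theta>) * N) \<le> N * H"
      using K_mult_le by (meson mult_left_mono of_nat_0_le_iff order_trans)
    then have "K * (1 - 2 * \<theta>) \<le> H" using N_pos by (simp add: mult_ac)
    then have "K * (1 - 2 * \<theta>) * (1 + 3 * \<theta>) \<le> (\<theta> * N + 1) * (1 + 3 * \<theta>)"
      using \<theta>_bounds H_bounds(2) by (intro mult_right_mono) auto
    moreover have "real K * 1 \<le> real K * ((1 - 2 * \<theta>) * (1 + 3 * \<theta>))"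
      using \<theta>_bounds \<theta>_square_le
      by (intro mult_left_mono) (auto simp: algebra_simps power2_eq_square)
    ultimately have "real K \<le> (\<theta> * N + 1) * (1 + 3 * \<theta>)" by (simp add: mult_ac)
    then show ?thesis using N_large \<theta>_bounds by (simp add: algebra_simps power2_eq_square)
  qed
  have "J * (real K + 1) \<le> J * (\<theta> * N * (1 + 4 * \<theta>))" using K_le by (intro mult_left_mono) auto
  also have "\<dots> = \<theta> * J * (N * (1 + 4 * \<theta>))" by simp
  also have "\<dots> \<le> (1 + 3 * \<theta>) * (N * (1 + 4 * \<theta>))"
    using J_le \<theta>_bounds by (intro mult_right_mono) auto
  also have "\<dots> = N + 7 * (\<theta> * N) + 12 * (\<theta>\<^sup>2 * N)" by (simp add: algebra_simps power2_eq_square)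
  finally show ?thesis using N_large \<theta>_square_N_le by (simp add: algebra_simps)
qed

lemma obtain_short_arith_prog_superset:
  fixes B D :: "int set" and \<theta> :: real
  assumes \<theta>_bounds: "0 < \<theta>" "\<theta> \<le> 1 / 100" and fin: "finite B" "finite D"
    and missing: "\<And>x. x \<in> B \<Longrightarrow> card {y \<in> B. x + y \<notin> D} \<le> \<mu>"
    and card_D_le: "card D + 4 * \<mu> + 2 \<le> 2 * card B + w"
    and w_le: "w \<le> \<theta>\<^sup>2 * card B" and B_large: "3 \<le> \<theta>\<^sup>2 * card B"
  obtains P where "arith_prog P" "B \<subseteq> P" "card P \<le> (1 + 8 * \<theta>) * card B"
    "2 * card B \<le> card D + 2 * \<mu> + 1"
proof -
  let ?N = "card B"
  define H where "H = nat \<lceil>\<theta> * ?N\<rceil>"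
  define J where "J = nat \<lceil>?N / (real H - real w)\<rceil>"
  have "0 \<le> \<theta> * ?N" using \<theta>_bounds(1) by simp
  then have H_bounds: "\<theta> * ?N \<le> H" "H \<le> \<theta> * ?N + 1" unfolding H_def by linarith+
  have \<theta>_square_N_le: "100 * (\<theta>\<^sup>2 * ?N) \<le> \<theta> * ?N" and \<theta>_N_le: "100 * (\<theta> * ?N) \<le> ?N"
    using \<theta>_bounds mult_right_mono[of \<theta> "1 / 100" "\<theta> * ?N"]
      mult_right_mono[of \<theta> "1 / 100" "real ?N"]
    by (simp_all add: power2_eq_square)
  have "real w < H" using H_bounds(1) w_le B_large \<theta>_square_N_le by linarith
  have small: "real (2 * (H + 2 * w)) < ?N"
    using H_bounds(2) w_le B_large \<theta>_square_N_le \<theta>_N_le by simp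
  have J_bounds: "?N / (real H - real w) \<le> J" "J \<le> ?N / (real H - real w) + 1"
    using \<open>real w < H\<close> by (simp_all add: J_def)
  then have "real ?N \<le> real (J * (H - w))"
    using \<open>real w < H\<close> by (simp add: of_nat_diff field_simps)
  then have N_le_J_mult: "?N \<le> J * (H - w)" by (simp only: of_nat_le_iff)
  have "w < H" "2 * (H + 2 * w) < ?N" using \<open>real w < H\<close> small by linarith+
  then obtain P K where P: "arith_prog P" "B \<subseteq> P" "card P = J * (K + 1) + 1"
    and K_mult_le: "K * (?N - (H + 2 * w)) \<le> ?N * H" and "2 * ?N \<le> card D + 2 * \<mu> + 1"
    using obtain_arith_prog_superset[OF fin missing card_D_le _ _ N_le_J_mult] by blast
  have "K * (real ?N - (real H + 2 * real w)) = real (K * (?N - (H + 2 * w)))"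
    using small by (simp add: of_nat_diff)
  also have "\<dots> \<le> real ?N * real H" using of_nat_mono[OF K_mult_le] by simp
  finally have "J * (real K + 1) + 1 \<le> (1 + 8 * \<theta>) * ?N"
    using arith_prog_length_le[OF \<theta>_bounds B_large w_le H_bounds J_bounds(2)] by simp
  then have "card P \<le> (1 + 8 * \<theta>) * ?N" unfolding P(3) by (simp add: algebra_simps)
  with P(1,2) \<open>2 * ?N \<le> card D + 2 * \<mu> + 1\<close> show thesis using that by blast
qed

lemma large_almost_closed_subset_arith_prog:
  fixes B D :: "int set" and \<eta> \<kappa> :: real and m :: nat
  assumes \<eta>_bounds: "0 < \<eta>" "\<eta> \<le> 1" and \<kappa>_bounds: "0 < \<kappa>" "\<kappa> \<le> (\<eta> / 500)\<^sup>2"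
    and m_large: "12 \<le> \<kappa> * m"
    and fin: "finite B" "finite D" and card_D_le: "card D \<le> m"
    and missing: "\<And>x. x \<in> B \<Longrightarrow> card {y \<in> B. x + y \<notin> D} \<le> \<kappa> * m"
    and B_large: "(1 - 3 * \<kappa>) * m / 2 \<le> card B"
  shows "\<exists>P. arith_prog P \<and> B \<subseteq> P \<and> card P \<le> m / 2 + \<eta> * m"
proof -
  define \<theta> where "\<theta> = \<eta> / 100"
  define \<mu> where "\<mu> = nat \<lfloor>\<kappa> * m\<rfloor>"
  define w where "w = nat \<lceil>7 * \<kappa> * m\<rceil> + 2"
  have \<theta>_bounds: "0 < \<theta>" "\<theta> \<le> 1 / 100" using \<eta>_bounds by (simp_all add: \<theta>_def)
  have \<theta>_square_le: "\<theta>\<^sup>2 \<le> \<theta> / 100"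
    using \<theta>_bounds power2_le_mult[of \<theta> "1 / 100"] by simp
  have \<kappa>_le: "25 * \<kappa> \<le> \<theta>\<^sup>2" using \<kappa>_bounds(2) by (simp add: \<theta>_def power2_eq_square)
  have \<mu>_le: "\<mu> \<le> \<kappa> * m" using \<kappa>_bounds by (simp add: \<mu>_def)
  have w_bounds: "7 * \<kappa> * m + 2 \<le> w" "w \<le> 7 * \<kappa> * m + 3"
    using m_large unfolding w_def by linarith+
  have "2 / 3 * m \<le> (1 - 3 * \<kappa>) * m"
    using \<kappa>_le \<theta>_bounds \<theta>_square_le by (intro mult_right_mono) auto
  then have "m \<le> 3 * real (card B)" using B_large by simp
  then have "8 * \<kappa> * m \<le> 8 * \<kappa> * (3 * card B)" using \<kappa>_bounds by (intro mult_left_mono) auto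
  also have "\<dots> \<le> 25 * \<kappa> * card B" using \<kappa>_bounds by simp
  also have "\<dots> \<le> \<theta>\<^sup>2 * card B" using \<kappa>_le by (intro mult_right_mono) auto
  finally have \<kappa>_m_le: "8 * \<kappa> * m \<le> \<theta>\<^sup>2 * card B" .
  have "card {y \<in> B. x + y \<notin> D} \<le> \<mu>" if "x \<in> B" for x
    using missing[OF that] unfolding \<mu>_def by linarith
  moreover have "real (card D + 4 * \<mu> + 2) \<le> real (2 * card B + w)"
    using card_D_le \<mu>_le w_bounds(1) B_large by (simp add: algebra_simps)
  then have "card D + 4 * \<mu> + 2 \<le> 2 * card B + w" by (simp only: of_nat_le_iff)
  moreover have "w \<le> \<theta>\<^sup>2 * card B" "3 \<le> \<theta>\<^sup>2 * card B" using w_bounds(2) m_large \<kappa>_m_le by simp_all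
  ultimately obtain P where P: "arith_prog P" "B \<subseteq> P" "card P \<le> (1 + 8 * \<theta>) * card B"
    and "2 * card B \<le> card D + 2 * \<mu> + 1"
    using obtain_short_arith_prog_superset[OF \<theta>_bounds fin] by blast
  then have "2 * real (card B) \<le> m + 3 * (\<kappa> * m)" using card_D_le \<mu>_le m_large by linarith
  moreover have "25 * (\<kappa> * m) \<le> \<theta> / 100 * m"
    using \<kappa>_le \<theta>_square_le mult_right_mono[of "25 * \<kappa>" "\<theta> / 100" "real m"] by simp
  moreover from calculation have "\<theta> * card B \<le> \<theta> * m"
    using \<theta>_bounds mult_right_mono[of \<theta> "1 / 100" "real m"] by (intro mult_left_mono) auto
  moreover have "0 \<le> \<theta> * m" using \<theta>_bounds(1) by simp
  ultimately have "card B + 8 * (\<theta> * card B) \<le> m / 2 + 100 * (\<theta> * m)" by linarith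
  then have "(1 + 8 * \<theta>) * card B \<le> m / 2 + \<eta> * m" by (simp add: \<theta>_def algebra_simps)
  then show ?thesis using P by (intro exI[of _ P]) simp
qed

section \<open>Containers\<close>

lemma card_sumset_mono:
  fixes A U V :: "'a::ab_group_add set"
  assumes "finite A" "U \<subseteq> A" "V \<subseteq> A"
  shows "card (U + V) \<le> card (A + A)"
  using assms by (intro card_mono finite_set_plus set_plus_mono2)

lemma card_le_card_sumset:
  fixes A :: "'a::ab_group_add set"
  assumes "finite A"
  shows "card A \<le> card (A + A)"
proof (cases "A = {}")
  case False
  then obtain a where "a \<in> A" by auto
  then show ?thesis
    using assms by (intro card_inj_on_le[of "(+) a"]) (auto intro: finite_set_plus)
qed simp

definition rep_count :: "'a::ab_group_add set \<Rightarrow> 'a set \<Rightarrow> 'a \<Rightarrow> nat" where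
  "rep_count S T z = card {\<sigma> \<in> S. z - \<sigma> \<in> T}"

lemma rep_count_insert:
  assumes "finite S" "x \<notin> S"
  shows "rep_count (insert x S) T z = rep_count S T z + of_bool (z - x \<in> T)"
proof -
  have "{\<sigma> \<in> insert x S. z - \<sigma> \<in> T} = {\<sigma> \<in> S. z - \<sigma> \<in> T} \<union> (if z - x \<in> T then {x} else {})"
    by auto
  then show ?thesis using assms by (simp add: rep_count_def)
qed

lemma rep_count_eq_0_iff:
  assumes "finite S"
  shows "rep_count S T z = 0 \<longleftrightarrow> z \<notin> S + T"
proof
  show "z \<notin> S + T" if "rep_count S T z = 0"
    using that assms by (auto simp: rep_count_def elim!: set_plus_elim)
  have "z \<in> S + T" if "\<sigma> \<in> S" "z - \<sigma> \<in> T" for \<sigma>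
    using set_plus_intro[OF that] by simp
  then show "rep_count S T z = 0" if "z \<notin> S + T"
    using that assms by (auto simp: rep_count_def)
qed

lemma sum_min_rep_count_insert:
  assumes "finite Z" "finite S" "x \<notin> S" "(+) x ` T \<subseteq> Z"
  shows "(\<Sum>z\<in>Z. min (rep_count (insert x S) T z) R)
    = (\<Sum>z\<in>Z. min (rep_count S T z) R) + card {t \<in> T. rep_count S T (x + t) < R}"
proof -
  have "min (rep_count (insert x S) T z) R
      = min (rep_count S T z) R + of_bool (z - x \<in> T \<and> rep_count S T z < R)" for z
    using assms(2,3) by (auto simp: rep_count_insert)
  then have "(\<Sum>z\<in>Z. min (rep_count (insert x S) T z) R)
      = (\<Sum>z\<in>Z. min (rep_count S T z) R) + card {z \<in> Z. z - x \<in> T \<and> rep_count S T z < R}"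
    using assms(1) by (simp add: sum.distrib of_bool_def sum.If_cases Int_def)
  also have "{z \<in> Z. z - x \<in> T \<and> rep_count S T z < R} = (+) x ` {t \<in> T. rep_count S T (x + t) < R}"
    using assms(4) by (auto intro: image_eqI[of _ _ "_ - x"])
  finally show ?thesis by (simp add: card_image)
qed

text \<open>\<open>S\<close> is maximal among the sets whose representation counts, capped at \<open>R\<close>, sum up to at least
  \<open>\<theta> * card T * card S\<close>. The capped sum is at most \<open>R * card (A + T)\<close>, so \<open>S\<close> is small; by
  maximality no further element of \<open>A\<close> contributes many new sums.\<close>

lemma obtain_saturating_subset:
  fixes A T :: "'a::ab_group_add set" and \<theta> :: real and m R :: nat
  assumes "finite A" "finite T" "card (A + T) \<le> m"
  obtains S where "S \<subseteq> A" "\<theta> * card T * card S \<le> real R * m"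
    "\<And>x. x \<in> A - S \<Longrightarrow> card {t \<in> T. rep_count S T (x + t) < R} \<le> \<theta> * card T"
proof -
  define \<Phi> where "\<Phi> S = (\<Sum>z\<in>A + T. min (rep_count S T z) R)" for S
  define \<S> where "\<S> = {S. S \<subseteq> A \<and> \<theta> * card T * card S \<le> \<Phi> S}"
  have fin: "finite (A + T)" using assms(1,2) by (rule finite_set_plus)
  have "finite \<S>" by (rule finite_subset[of _ "Pow A"]) (auto simp: \<S>_def assms(1))
  moreover have "{} \<in> \<S>" by (simp add: \<S>_def)
  ultimately obtain S where "S \<in> \<S>" and maximal: "\<And>S'. S' \<in> \<S> \<Longrightarrow> S \<subseteq> S' \<Longrightarrow> S' = S"
    using finite_has_maximal[of \<S>] by blast
  then have S: "S \<subseteq> A" "\<theta> * card T * card S \<le> \<Phi> S" by (simp_all add: \<S>_def)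
  show thesis
  proof (rule that[OF S(1)])
    have "\<Phi> S \<le> card (A + T) * R"
      unfolding \<Phi>_def using sum_bounded_above[of "A + T" "\<lambda>z. min (rep_count S T z) R" R] by simp
    also have "\<dots> \<le> R * m" using assms(3) by simp
    finally have "real (\<Phi> S) \<le> real (R * m)" by (rule of_nat_mono)
    with S(2) show "\<theta> * card T * card S \<le> real R * m" by simp
    show "card {t \<in> T. rep_count S T (x + t) < R} \<le> \<theta> * card T" if x_mem: "x \<in> A - S" for x
    proof -
      have "insert x S \<notin> \<S>" using maximal[of "insert x S"] x_mem by blast
      then have "\<Phi> (insert x S) < \<theta> * card T * card (insert x S)"
        using x_mem S(1) by (simp add: \<S>_def)
      moreover have "\<Phi> (insert x S) = \<Phi> S + card {t \<in> T. rep_count S T (x + t) < R}"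
        unfolding \<Phi>_def using fin x_mem S(1) assms(1) finite_subset
        by (intro sum_min_rep_count_insert) auto
      moreover have "card (insert x S) = card S + 1"
        using x_mem finite_subset[OF S(1) assms(1)] by simp
      ultimately show ?thesis using S(2) by (simp add: algebra_simps)
    qed
  qed
qed

definition popular_shifts :: "'a::ab_group_add set \<Rightarrow> 'a set \<Rightarrow> 'a set" where
  "popular_shifts T D = {x. card T \<le> 2 * card {t \<in> T. x + t \<in> D}}"

lemma obtain_subset_covering_popular:
  fixes A T :: "'a::ab_group_add set"
  assumes "finite A" "finite T" "card (A + T) \<le> m"
  obtains S where "S \<subseteq> A" "card T * card S \<le> 2 * m" "A \<subseteq> popular_shifts T (S + T)"
proof -
  obtain S where S: "S \<subseteq> A" "1/2 * card T * card S \<le> real 1 * m"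
    and new: "\<And>x. x \<in> A - S \<Longrightarrow> card {t \<in> T. rep_count S T (x + t) < 1} \<le> 1/2 * card T"
    using obtain_saturating_subset[OF assms] by blast
  have "finite S" using S(1) assms(1) by (rule finite_subset)
  have "x \<in> popular_shifts T (S + T)" if "x \<in> A" for x
  proof (cases "x \<in> S")
    case True
    then have "{t \<in> T. x + t \<in> S + T} = T" by auto
    then show ?thesis by (simp add: popular_shifts_def)
  next
    case False
    then have "real (card {t \<in> T. x + t \<notin> S + T}) \<le> 1/2 * card T"
      using new[of x] that \<open>finite S\<close> by (simp add: rep_count_eq_0_iff)
    moreover have "card T \<le> card {t \<in> T. x + t \<in> S + T} + card {t \<in> T. x + t \<notin> S + T}"
      using card_Un_le[of "{t \<in> T. x + t \<in> S + T}" "{t \<in> T. x + t \<notin> S + T}"]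
      by (simp flip: Collect_disj_eq conj_disj_distribL)
    ultimately show ?thesis by (simp add: popular_shifts_def)
  qed
  moreover have "real (card T * card S) \<le> real (2 * m)" using S(2) by simp
  then have "card T * card S \<le> 2 * m" by (simp only: of_nat_le_iff)
  ultimately show thesis using that S(1) by blast
qed

lemma finite_popular_shifts:
  assumes "finite T" "T \<noteq> {}" "finite D"
  shows "finite (popular_shifts T D)"
proof (rule finite_subset)
  show "popular_shifts T D \<subseteq> (\<lambda>(z, t). z - t) ` (D \<times> T)"
  proof
    fix x assume "x \<in> popular_shifts T D"
    then have "0 < card {t \<in> T. x + t \<in> D}"
      using assms(1,2) card_gt_0_iff[of T] unfolding popular_shifts_def by fastforce
    then obtain t where "t \<in> T" "x + t \<in> D" by (auto simp: card_gt_0_iff)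
    then show "x \<in> (\<lambda>(z, t). z - t) ` (D \<times> T)" by (intro image_eqI[of _ _ "(x + t, t)"]) auto
  qed
qed (use assms in auto)

lemma card_popular_shifts_le:
  assumes "finite T" "T \<noteq> {}" "finite D"
  shows "card (popular_shifts T D) \<le> 2 * card D"
proof -
  let ?X = "popular_shifts T D"
  have fin: "finite ?X" by (rule finite_popular_shifts[OF assms])
  have "card ?X * card T = (\<Sum>x\<in>?X. card T)" by simp
  also have "\<dots> \<le> (\<Sum>x\<in>?X. 2 * card {t \<in> T. x + t \<in> D})"
    by (rule sum_mono) (simp add: popular_shifts_def)
  also have "\<dots> = 2 * (\<Sum>t\<in>T. card {x \<in> ?X. x + t \<in> D})"
    using sum_multicount_gen[OF fin assms(1), of "\<lambda>x t. x + t \<in> D"] by (simp flip: sum_distrib_left)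
  also have "\<dots> \<le> 2 * (\<Sum>t\<in>T. card D)"
  proof -
    have "card {x \<in> ?X. x + t \<in> D} \<le> card D" for t
      by (rule card_inj_on_le[of "\<lambda>x. x + t"]) (use assms(3) in auto)
    then show ?thesis by (intro mult_left_mono sum_mono) auto
  qed
  finally have "card ?X * card T \<le> 2 * card D * card T" by (simp add: mult_ac)
  then show ?thesis using assms by (simp add: card_gt_0_iff)
qed

lemma exists_element_of_many:
  fixes N :: "'i \<Rightarrow> 'a set"
  assumes "finite A" "A \<noteq> {}" "finite I"
    and N: "\<And>i. i \<in> I \<Longrightarrow> N i \<subseteq> A" "\<And>i. i \<in> I \<Longrightarrow> R \<le> card (N i)"
  shows "\<exists>a\<in>A. R * card I \<le> card A * card {i \<in> I. a \<in> N i}"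
proof (rule ccontr)
  assume "\<not> ?thesis"
  then have "(\<Sum>a\<in>A. card A * card {i \<in> I. a \<in> N i}) < (\<Sum>a\<in>A. R * card I)"
    using assms by (intro sum_strict_mono) (auto simp: not_le)
  then have "(\<Sum>a\<in>A. card {i \<in> I. a \<in> N i}) < R * card I" by (simp flip: sum_distrib_left)
  also have "R * card I = (\<Sum>i\<in>I. R)" by simp
  also have "\<dots> \<le> (\<Sum>i\<in>I. card {a \<in> A. a \<in> N i})"
  proof (rule sum_mono)
    fix i assume "i \<in> I"
    moreover from this N(1) have "{a \<in> A. a \<in> N i} = N i" by blast
    ultimately show "R \<le> card {a \<in> A. a \<in> N i}" using N(2) by simp
  qed
  also have "\<dots> = (\<Sum>a\<in>A. card {i \<in> I. a \<in> N i})"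
    using sum_multicount_gen[OF assms(1,3), of "\<lambda>a i. a \<in> N i" "\<lambda>i. card {a \<in> A. a \<in> N i}"] by simp
  finally show False by simp
qed

lemma exists_hitting_set:
  fixes N :: "'i \<Rightarrow> 'a set"
  assumes "finite A" "A \<noteq> {}" "finite I" "R \<le> card A"
    and N: "\<And>i. i \<in> I \<Longrightarrow> N i \<subseteq> A" "\<And>i. i \<in> I \<Longrightarrow> R \<le> card (N i)"
  shows "\<exists>T\<subseteq>A. card T \<le> t \<and> card {i \<in> I. N i \<inter> T = {}} \<le> card I * (1 - R / card A) ^ t"
proof (induction t)
  case 0
  then show ?case by (intro exI[of _ "{}"]) auto
next
  case (Suc t)
  then obtain T where T: "T \<subseteq> A" "card T \<le> t"
    "card {i \<in> I. N i \<inter> T = {}} \<le> card I * (1 - R / card A) ^ t" by auto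
  let ?U = "{i \<in> I. N i \<inter> T = {}}"
  have fin: "finite ?U" using assms(3) by simp
  have A_pos: "0 < card A" using assms(1,2) by (simp add: card_gt_0_iff)
  obtain a where a: "a \<in> A" "R * card ?U \<le> card A * card {i \<in> ?U. a \<in> N i}"
    using exists_element_of_many[OF assms(1,2) fin, of N R] N by auto
  let ?V = "{i \<in> ?U. a \<in> N i}"
  have V: "?V \<subseteq> ?U" "finite ?V" using assms(3) by auto
  have "{i \<in> I. N i \<inter> insert a T = {}} = ?U - ?V" by auto
  then have "real (card {i \<in> I. N i \<inter> insert a T = {}}) = real (card ?U) - real (card ?V)"
    using card_Diff_subset[OF V(2,1)] card_mono[OF fin V(1)] by (simp only: of_nat_diff)
  also have "\<dots> \<le> card ?U * (1 - R / card A)"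
  proof -
    have "real R * card ?U \<le> real (card A) * card ?V" using of_nat_mono[OF a(2)] by simp
    then show ?thesis using A_pos by (simp add: field_simps)
  qed
  also have "\<dots> \<le> (card I * (1 - R / card A) ^ t) * (1 - R / card A)"
    using T(3) assms(4) A_pos by (intro mult_right_mono) (auto simp: field_simps)
  finally have "card {i \<in> I. N i \<inter> insert a T = {}} \<le> card I * (1 - R / card A) ^ Suc t"
    by (simp add: mult_ac)
  moreover have "card (insert a T) \<le> Suc t"
    using T(2) card_insert_le_m1[of "Suc t" T a] by simp
  ultimately show ?case using T(1) a(1) by (intro exI[of _ "insert a T"]) auto
qed

definition missing_pairs :: "'a::ab_group_add set \<Rightarrow> 'a set \<Rightarrow> ('a \<times> 'a) set" where
  "missing_pairs A D = (SIGMA x:A. {y \<in> A. x + y \<notin> D})"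

lemma card_missing_pairs:
  "finite A \<Longrightarrow> card (missing_pairs A D) = (\<Sum>x\<in>A. card {y \<in> A. x + y \<notin> D})"
  by (simp add: missing_pairs_def)

definition unhit_pairs :: "'a::ab_group_add set \<Rightarrow> 'a set \<Rightarrow> nat \<Rightarrow> 'a set \<Rightarrow> ('a \<times> 'a) set" where
  "unhit_pairs A S R T = {(x, y) \<in> A \<times> A. R \<le> rep_count S A (x + y) \<and> (\<forall>c\<in>T. x + y - c \<notin> S)}"

lemma missing_pairs_Un_subset:
  "missing_pairs A ((S \<union> T) + (S \<union> T)) \<subseteq>
    S \<times> A \<union> (SIGMA x:A - S. {y \<in> A. rep_count S A (x + y) < R}) \<union> unhit_pairs A S R T"
proof -
  have "x + y - c \<notin> S" if "x + y \<notin> (S \<union> T) + (S \<union> T)" "c \<in> T" for x y c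
  proof
    assume "x + y - c \<in> S"
    then have "(x + y - c) + c \<in> (S \<union> T) + (S \<union> T)" using that(2) by (intro set_plus_intro) auto
    with that(1) show False by simp
  qed
  then show ?thesis by (auto simp: missing_pairs_def unhit_pairs_def not_less)
qed

lemma exists_few_unhit_pairs:
  assumes "finite A" "A \<noteq> {}" "R \<le> card A" "S \<subseteq> A"
  shows "\<exists>T\<subseteq>A. card T \<le> t \<and> card (unhit_pairs A S R T) \<le> (card A)\<^sup>2 * (1 - R / card A) ^ t"
proof -
  define N where "N = (\<lambda>(x, y). {c \<in> A. x + y - c \<in> S})"
  define I where "I = {(x, y) \<in> A \<times> A. R \<le> rep_count S A (x + y)}"
  have card_N: "card (N (x, y)) = rep_count S A (x + y)" for x y
  proof -
    have "bij_betw (\<lambda>c. x + y - c) (N (x, y)) {\<sigma> \<in> S. x + y - \<sigma> \<in> A}"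
      by (rule bij_betwI[where g = "\<lambda>c. x + y - c"]) (use assms(4) in \<open>auto simp: N_def\<close>)
    then show ?thesis unfolding rep_count_def by (rule bij_betw_same_card)
  qed
  have "I \<subseteq> A \<times> A" by (auto simp: I_def)
  then have I_bounds: "finite I" "card I \<le> (card A)\<^sup>2"
    using assms(1) card_mono[of "A \<times> A" I] finite_subset[of I "A \<times> A"]
    by (simp_all add: card_cartesian_product power2_eq_square)
  have "\<exists>T\<subseteq>A. card T \<le> t \<and> card {i \<in> I. N i \<inter> T = {}} \<le> card I * (1 - R / card A) ^ t"
    by (rule exists_hitting_set) (use assms I_bounds card_N in \<open>auto simp: N_def I_def\<close>)
  then obtain T where T: "T \<subseteq> A" "card T \<le> t"
    "card {i \<in> I. N i \<inter> T = {}} \<le> card I * (1 - R / card A) ^ t"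
    by blast
  moreover have "unhit_pairs A S R T = {i \<in> I. N i \<inter> T = {}}"
    using T(1) by (auto simp: unhit_pairs_def I_def N_def)
  moreover have "card I * (1 - R / card A) ^ t \<le> (card A)\<^sup>2 * (1 - R / card A) ^ t"
    using I_bounds(2) assms(1-3)
    by (intro mult_right_mono of_nat_mono zero_le_power) (simp_all add: card_gt_0_iff)
  ultimately show ?thesis by (intro exI[of _ T]) auto
qed

lemma card_missing_pairs_Un_le:
  fixes A S T :: "'a::ab_group_add set" and \<theta> :: real
  assumes "finite A" "S \<subseteq> A" "0 \<le> \<theta>"
    and few: "\<And>x. x \<in> A - S \<Longrightarrow> card {y \<in> A. rep_count S A (x + y) < R} \<le> \<theta> * card A"
  shows "card (missing_pairs A ((S \<union> T) + (S \<union> T)))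
    \<le> real (card S) * card A + \<theta> * (card A)\<^sup>2 + card (unhit_pairs A S R T)"
proof -
  let ?W = "SIGMA x:A - S. {y \<in> A. rep_count S A (x + y) < R}"
  have "finite (unhit_pairs A S R T)"
    by (rule finite_subset[of _ "A \<times> A"]) (use assms(1) in \<open>auto simp: unhit_pairs_def\<close>)
  then have "finite (S \<times> A \<union> ?W \<union> unhit_pairs A S R T)"
    using assms(1) finite_subset[OF assms(2)] by (intro finite_UnI finite_SigmaI) auto
  then have "card (missing_pairs A ((S \<union> T) + (S \<union> T))) \<le> card (S \<times> A \<union> ?W \<union> unhit_pairs A S R T)"
    by (intro card_mono missing_pairs_Un_subset)
  also have "\<dots> \<le> card (S \<times> A) + card ?W + card (unhit_pairs A S R T)"
    by (meson add_mono card_Un_le le_trans order_refl)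
  finally have "card (missing_pairs A ((S \<union> T) + (S \<union> T)))
      \<le> real (card S) * card A + card ?W + card (unhit_pairs A S R T)"
    by (simp add: card_cartesian_product flip: of_nat_mult of_nat_add)
  moreover have "card ?W \<le> \<theta> * (card A)\<^sup>2"
  proof -
    have "real (card ?W) = (\<Sum>x\<in>A - S. real (card {y \<in> A. rep_count S A (x + y) < R}))"
      using assms(1) by (subst card_SigmaI) auto
    also have "\<dots> \<le> (\<Sum>x\<in>A - S. \<theta> * card A)" by (rule sum_mono) (rule few)
    also have "\<dots> = card (A - S) * (\<theta> * card A)" by simp
    also have "\<dots> \<le> card A * (\<theta> * card A)"
      using assms by (intro mult_right_mono of_nat_mono card_mono) auto
    finally show ?thesis by (simp add: power2_eq_square mult_ac)
  qed
  ultimately show ?thesis by linarith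
qed

lemma obtain_basis_missing_le:
  fixes A :: "'a::ab_group_add set" and \<theta> :: real and m R t :: nat
  assumes "finite A" "A \<noteq> {}" "card (A + A) \<le> m" "0 < \<theta>" "R \<le> card A"
  obtains F where "F \<subseteq> A" "card F \<le> t + real R * m / (\<theta> * card A)"
    "card (missing_pairs A (F + F))
      \<le> real R * m / \<theta> + \<theta> * (card A)\<^sup>2 + (card A)\<^sup>2 * (1 - R / card A) ^ t"
proof -
  have A_pos: "0 < card A" using assms by (simp add: card_gt_0_iff)
  obtain S where S: "S \<subseteq> A" "\<theta> * card A * card S \<le> real R * m"
    and few: "\<And>x. x \<in> A - S \<Longrightarrow> card {y \<in> A. rep_count S A (x + y) < R} \<le> \<theta> * card A"
    using obtain_saturating_subset[OF assms(1,1,3), of \<theta> R] by blast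
  obtain T where T: "T \<subseteq> A" "card T \<le> t"
    "card (unhit_pairs A S R T) \<le> (card A)\<^sup>2 * (1 - R / card A) ^ t"
    using exists_few_unhit_pairs[OF assms(1,2,5) S(1), of t] by blast
  show thesis
  proof (rule that[of "S \<union> T"])
    show "S \<union> T \<subseteq> A" using S T by auto
    have "real (card S) \<le> real R * m / (\<theta> * card A)"
      using S(2) A_pos assms(4) by (simp add: field_simps)
    moreover have "card (S \<union> T) \<le> card S + card T" by (rule card_Un_le)
    ultimately show "card (S \<union> T) \<le> t + real R * m / (\<theta> * card A)" using T(2) by linarith
    have "real (card S) * card A \<le> real R * m / \<theta>"
      using S(2) assms(4) by (simp add: field_simps)
    then show "card (missing_pairs A ((S \<union> T) + (S \<union> T)))
        \<le> real R * m / \<theta> + \<theta> * (card A)\<^sup>2 + (card A)\<^sup>2 * (1 - R / card A) ^ t"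
      using card_missing_pairs_Un_le[OF assms(1) S(1) less_imp_le[OF assms(4)] few, of T] T(3)
      by linarith
  qed
qed

lemma one_minus_divide_power_le:
  fixes \<gamma> \<theta> r s :: real and t :: nat
  assumes "0 < \<theta>" "0 \<le> r" "r \<le> s" "0 < s" and r_large: "ln (1 / \<theta>) \<le> r * \<gamma>" and "\<gamma> * s \<le> t"
  shows "(1 - r / s) ^ t \<le> \<theta>"
proof -
  have "r * \<gamma> \<le> r * (t / s)" using assms by (intro mult_left_mono) (simp_all add: pos_le_divide_eq)
  with r_large have "- (t * (r / s)) \<le> ln \<theta>" using assms(1) by (simp add: ln_div mult.commute)
  have "(1 - r / s) ^ t \<le> exp (- (r / s)) ^ t"
    using assms(2-4) exp_ge_add_one_self[of "- (r / s)"] by (intro power_mono) auto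
  also have "\<dots> = exp (- (t * (r / s)))" by (simp flip: exp_of_nat_mult)
  also have "\<dots> \<le> exp (ln \<theta>)"
    using \<open>- (t * (r / s)) \<le> ln \<theta>\<close> by (rule iffD2[OF exp_le_cancel_iff])
  finally show ?thesis using assms(1) by simp
qed

lemma exists_small_basis_of_scale:
  fixes A :: "'a::ab_group_add set" and \<gamma> \<theta> :: real and m R :: nat
  assumes A_sumset: "finite A" "A \<noteq> {}" "card (A + A) \<le> m" and pos: "0 < \<gamma>" "0 < \<theta>"
    and R_bounds: "ln (1 / \<theta>) \<le> R * (\<gamma> / 4)" "R \<le> card A" and \<gamma>_large: "1 \<le> \<gamma> / 4 * card A"
    and m_bounds: "real R * m \<le> \<gamma> / 2 * \<theta> * (card A)\<^sup>2" "real R * m \<le> \<theta>\<^sup>2 * (card A)\<^sup>2"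
  shows "\<exists>F\<subseteq>A. card F \<le> \<gamma> * card A \<and> card (missing_pairs A (F + F)) \<le> 3 * \<theta> * (card A)\<^sup>2"
proof -
  let ?s = "card A"
  define t where "t = nat \<lfloor>\<gamma> / 2 * ?s\<rfloor>"
  have s_pos: "0 < ?s" using A_sumset by (simp add: card_gt_0_iff)
  have t_bounds: "t \<le> \<gamma> / 2 * ?s" "\<gamma> / 4 * ?s \<le> t" using \<gamma>_large unfolding t_def by linarith+
  obtain F where F: "F \<subseteq> A" "card F \<le> t + real R * m / (\<theta> * ?s)"
    "card (missing_pairs A (F + F)) \<le> real R * m / \<theta> + \<theta> * ?s\<^sup>2 + ?s\<^sup>2 * (1 - R / ?s) ^ t"
    using obtain_basis_missing_le[OF A_sumset pos(2) R_bounds(2)] by blast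
  have "real R * m / (\<theta> * ?s) \<le> \<gamma> / 2 * ?s"
    using m_bounds(1) pos s_pos by (simp add: field_simps power2_eq_square)
  then have "card F \<le> \<gamma> * ?s" using F(2) t_bounds(1) by linarith
  have "(1 - real R / ?s) ^ t \<le> \<theta>"
    by (rule one_minus_divide_power_le[OF pos(2) _ _ _ R_bounds(1) t_bounds(2)])
      (use R_bounds(2) s_pos in auto)
  then have "?s\<^sup>2 * (1 - R / ?s) ^ t \<le> \<theta> * ?s\<^sup>2"
    by (subst mult.commute[of \<theta>], intro mult_left_mono) auto
  moreover have "real R * m / \<theta> \<le> \<theta> * ?s\<^sup>2"
    using m_bounds(2) pos(2) by (simp add: field_simps power2_eq_square)
  ultimately have "card (missing_pairs A (F + F)) \<le> 3 * (\<theta> * ?s\<^sup>2)" using F(3) by linarith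
  with F(1) \<open>card F \<le> \<gamma> * ?s\<close> show ?thesis by (auto simp: mult.assoc)
qed

lemma obtain_small_basis:
  fixes \<gamma> \<theta> :: real
  assumes "0 < \<gamma>" "0 < \<theta>"
  obtains c :: real where "0 < c"
    "\<And>(A :: 'a::ab_group_add set) m. \<lbrakk>finite A; A \<noteq> {}; card (A + A) \<le> m; m \<le> c * (card A)\<^sup>2\<rbrakk>
      \<Longrightarrow> \<exists>F\<subseteq>A. card F \<le> \<gamma> * card A \<and> card (missing_pairs A (F + F)) \<le> \<theta> * (card A)\<^sup>2"
proof -
  define \<theta>' where "\<theta>' = \<theta> / 3"
  define R where "R = nat \<lceil>ln (1 / \<theta>') / (\<gamma> / 4)\<rceil> + 1"
  define c where "c = Min {\<gamma> / 4, 1 / R, \<gamma> / 2 * \<theta>' / R, \<theta>'\<^sup>2 / R}"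
  have pos: "0 < \<theta>'" "0 < R" using assms by (simp_all add: \<theta>'_def R_def)
  have "ln (1 / \<theta>') / (\<gamma> / 4) \<le> R" unfolding R_def by linarith
  then have R_large: "ln (1 / \<theta>') \<le> R * (\<gamma> / 4)"
    using assms(1) by (subst (asm) pos_divide_le_eq) auto
  have c_le: "c \<le> \<gamma> / 4" "c \<le> 1 / R" "c \<le> \<gamma> / 2 * \<theta>' / R" "c \<le> \<theta>'\<^sup>2 / R"
    unfolding c_def by (rule Min_le; simp)+
  have "\<exists>F\<subseteq>A. card F \<le> \<gamma> * card A \<and> card (missing_pairs A (F + F)) \<le> 3 * \<theta>' * (card A)\<^sup>2"
    if A_sumset: "finite A" "A \<noteq> {}" "card (A + A) \<le> m" and m_le: "m \<le> c * (card A)\<^sup>2"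
    for A :: "'a set" and m
  proof -
    let ?s = "card A"
    have s_pos: "0 < ?s" using A_sumset by (simp add: card_gt_0_iff)
    have "real ?s \<le> real m" using card_le_card_sumset[OF A_sumset(1)] A_sumset(3) by simp
    with m_le have "real ?s * 1 \<le> ?s * (c * ?s)" by (simp add: power2_eq_square mult_ac)
    then have "1 \<le> c * ?s" using s_pos by simp
    then have one_le: "1 \<le> d * ?s" if "c \<le> d" for d
      using mult_right_mono[OF that, of "real ?s"] by simp
    have R_m_le: "real R * m \<le> d * ?s\<^sup>2" if "c \<le> d / R" for d :: real
    proof -
      have "m \<le> d / R * ?s\<^sup>2" using m_le mult_right_mono[OF that, of "real (?s\<^sup>2)"] by simp
      then show ?thesis using pos(2) by (simp add: field_simps)
    qed
    have "R \<le> ?s" using one_le[OF c_le(2)] pos(2) by (simp add: field_simps)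
    then show ?thesis
      by (rule exists_small_basis_of_scale[OF A_sumset assms(1) pos(1) R_large _
            one_le[OF c_le(1)] R_m_le[OF c_le(3)] R_m_le[OF c_le(4)]])
  qed
  moreover have "0 < c" using assms pos unfolding c_def by (subst Min_gr_iff) auto
  ultimately show thesis by (intro that[of c]) (auto simp: \<theta>'_def)
qed

definition common_nbrs :: "'a::ab_group_add set \<Rightarrow> 'a set \<Rightarrow> 'a set \<Rightarrow> 'a set" where
  "common_nbrs X D V = {x \<in> X. \<forall>v\<in>V. x + v \<in> D}"

definition container :: "'a::ab_group_add set \<Rightarrow> 'a set \<Rightarrow> 'a set \<Rightarrow> nat \<Rightarrow> 'a set" where
  "container X D V e =
    {x \<in> common_nbrs X D V. card {y \<in> common_nbrs X D V. x + y \<notin> D} \<le> e}"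

lemma container_subset: "container X D V e \<subseteq> X"
  by (auto simp: container_def common_nbrs_def)

lemma card_missing_container_le:
  assumes "finite X" "x \<in> container X D V e"
  shows "card {y \<in> container X D V e. x + y \<notin> D} \<le> e"
proof -
  have "card {y \<in> container X D V e. x + y \<notin> D} \<le> card {y \<in> common_nbrs X D V. x + y \<notin> D}"
    using assms(1) by (intro card_mono) (auto simp: container_def common_nbrs_def)
  also have "\<dots> \<le> e" using assms(2) by (simp add: container_def)
  finally show ?thesis .
qed

text \<open>\<open>V\<close> is maximal such that each of its elements accounts for \<open>e\<close> elements of \<open>X\<close> outside the
  common neighbourhood. An element of \<open>L\<close> outside the container could be added to \<open>V\<close>.\<close>

lemma obtain_saturated_common_nbrs:
  fixes X D L :: "'a::ab_group_add set"
  assumes "finite X" "finite L"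
  obtains V where "V \<subseteq> L" "e * card V \<le> card X" "L \<inter> common_nbrs X D V \<subseteq> container X D V e"
proof -
  define \<V> where "\<V> = {V. V \<subseteq> L \<and> e * card V + card (common_nbrs X D V) \<le> card X}"
  have "finite \<V>" by (rule finite_subset[of _ "Pow L"]) (auto simp: \<V>_def assms(2))
  moreover have "{} \<in> \<V>" by (simp add: \<V>_def common_nbrs_def)
  ultimately obtain V where "V \<in> \<V>" and maximal: "\<And>V'. V' \<in> \<V> \<Longrightarrow> V \<subseteq> V' \<Longrightarrow> V' = V"
    using finite_has_maximal[of \<V>] by blast
  then have V: "V \<subseteq> L" "e * card V + card (common_nbrs X D V) \<le> card X" by (simp_all add: \<V>_def)
  let ?N = "common_nbrs X D V"
  have "finite ?N" using assms(1) by (simp add: common_nbrs_def)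
  have "card {y \<in> ?N. x + y \<notin> D} \<le> e" if x_mem: "x \<in> L" "x \<in> ?N" for x
  proof (cases "x \<in> V")
    case True
    then have "{y \<in> ?N. x + y \<notin> D} = {}" by (auto simp: common_nbrs_def add.commute)
    then show ?thesis by (simp only: card.empty)
  next
    case False
    then have "insert x V \<notin> \<V>" using maximal[of "insert x V"] by blast
    then have "card X < e * card (insert x V) + card (common_nbrs X D (insert x V))"
      using x_mem V(1) by (simp add: \<V>_def)
    also have "e * card (insert x V) = e + e * card V"
      using False finite_subset[OF V(1) assms(2)] by simp
    also have "common_nbrs X D (insert x V) = ?N - {y \<in> ?N. x + y \<notin> D}"
      by (auto simp: common_nbrs_def add.commute)
    also have "card \<dots> = card ?N - card {y \<in> ?N. x + y \<notin> D}"
      using \<open>finite ?N\<close> by (simp add: card_Diff_subset)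
    finally show ?thesis
      using V(2) card_mono[of ?N "{y \<in> ?N. x + y \<notin> D}"] \<open>finite ?N\<close> by simp
  qed
  then have "L \<inter> ?N \<subseteq> container X D V e" by (auto simp: container_def)
  moreover have "e * card V \<le> card X" using V(2) by linarith
  ultimately show thesis using that V(1) by blast
qed

lemma card_many_missing_le:
  fixes A D :: "'a::ab_group_add set" and q :: real
  assumes "finite A" "0 < q"
  shows "card {x \<in> A. q < card {y \<in> A. x + y \<notin> D}} \<le> card (missing_pairs A D) / q"
proof -
  let ?H = "{x \<in> A. q < card {y \<in> A. x + y \<notin> D}}"
  have "card ?H * q = (\<Sum>x\<in>?H. q)" by simp
  also have "\<dots> \<le> (\<Sum>x\<in>?H. real (card {y \<in> A. x + y \<notin> D}))" by (rule sum_mono) auto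
  also have "\<dots> \<le> (\<Sum>x\<in>A. real (card {y \<in> A. x + y \<notin> D}))"
    using assms(1) by (intro sum_mono2) auto
  finally show ?thesis using assms by (simp add: card_missing_pairs pos_le_divide_eq)
qed

lemma obtain_container:
  fixes A X D :: "'a::ab_group_add set" and q :: real
  assumes "finite X" "A \<subseteq> X" "0 < q"
  obtains V where "V \<subseteq> A" "e * card V \<le> card X"
    "card (A - container X D V e) \<le> card (missing_pairs A D) / q + card V * q"
proof -
  let ?heavy = "{x \<in> A. q < card {y \<in> A. x + y \<notin> D}}"
  have fin: "finite A" using assms(1,2) finite_subset by blast
  then obtain V where V: "V \<subseteq> A - ?heavy" "e * card V \<le> card X"
    "(A - ?heavy) \<inter> common_nbrs X D V \<subseteq> container X D V e"
    using obtain_saturated_common_nbrs[OF assms(1), of "A - ?heavy" e D] by blast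
  have "finite V" using V(1) fin finite_subset by blast
  have "A - container X D V e \<subseteq> ?heavy \<union> (\<Union>v\<in>V. {y \<in> A. v + y \<notin> D})"
    using V(3) assms(2) by (auto simp: common_nbrs_def add.commute)
  then have "card (A - container X D V e) \<le> card (?heavy \<union> (\<Union>v\<in>V. {y \<in> A. v + y \<notin> D}))"
    using fin \<open>finite V\<close> by (intro card_mono) auto
  also have "\<dots> \<le> card ?heavy + (\<Sum>v\<in>V. card {y \<in> A. v + y \<notin> D})"
    by (rule order_trans[OF card_Un_le add_left_mono[OF card_UN_le[OF \<open>finite V\<close>]]])
  finally have "real (card (A - container X D V e))
      \<le> real (card ?heavy) + (\<Sum>v\<in>V. real (card {y \<in> A. v + y \<notin> D}))"
    by (simp flip: of_nat_sum of_nat_add)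
  also have "(\<Sum>v\<in>V. real (card {y \<in> A. v + y \<notin> D})) \<le> (\<Sum>v\<in>V. q)"
    by (rule sum_mono) (use V(1) in force)
  finally have "card (A - container X D V e) \<le> card (missing_pairs A D) / q + card V * q"
    using card_many_missing_le[OF fin assms(3), of D] by simp
  then show thesis using that V(1,2) by blast
qed

text \<open>The sets \<open>T\<close>, \<open>S\<close>, \<open>V\<close> are chosen from the whole ground set, at a cost of about \<open>\<tau>\<close> times the
  logarithm of its size; \<open>Y\<close> and \<open>F\<close> are chosen inside the popular set, which has at most
  \<open>2 * card (A + A)\<close> elements.\<close>

definition has_container ::
  "nat \<Rightarrow> nat \<Rightarrow> nat \<Rightarrow> 'a::ab_group_add set \<Rightarrow> 'a set \<Rightarrow> bool" where
  "has_container \<tau> g e A B \<longleftrightarrow> (\<exists>T S V Y F.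
     T \<noteq> {} \<and> T \<subseteq> A \<and> S \<subseteq> A \<and> V \<subseteq> A \<and> card T \<le> \<tau> \<and> card S \<le> \<tau> \<and> card V \<le> \<tau> \<and>
     F \<subseteq> Y \<and> Y \<subseteq> A \<and> card Y \<le> g \<and> A \<subseteq> popular_shifts T (S + T) \<and>
     B = container (popular_shifts T (S + T)) (F + F) V e \<and> A - Y \<subseteq> B)"

lemma has_container_almost_closed:
  assumes "has_container \<tau> g e A B" "finite A"
  obtains D where "finite B" "finite D" "card D \<le> card (A + A)"
    "\<And>x. x \<in> B \<Longrightarrow> card {y \<in> B. x + y \<notin> D} \<le> e"
proof -
  obtain T S V Y F where container: "T \<noteq> {}" "T \<subseteq> A" "S \<subseteq> A" "F \<subseteq> Y" "Y \<subseteq> A"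
    and B_eq: "B = container (popular_shifts T (S + T)) (F + F) V e"
    using assms(1) unfolding has_container_def by blast
  then have "F \<subseteq> A" by blast
  then have fin: "finite T" "finite S" "finite F" using container assms(2) finite_subset by blast+
  have X: "finite (popular_shifts T (S + T))"
    using fin container(1) by (intro finite_popular_shifts finite_set_plus)
  show thesis
  proof (rule that)
    show "finite B" unfolding B_eq using container_subset X by (rule finite_subset)
    show "finite (F + F)" using fin(3) fin(3) by (rule finite_set_plus)
    show "card (F + F) \<le> card (A + A)" by (rule card_sumset_mono[OF assms(2) \<open>F \<subseteq> A\<close> \<open>F \<subseteq> A\<close>])
    show "card {y \<in> B. x + y \<notin> F + F} \<le> e" if "x \<in> B" for x
      using card_missing_container_le[OF X] that unfolding B_eq .
  qed
qed

lemma card_Diff_has_container_le: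
  assumes "has_container \<tau> g e A B" "finite A" "B \<subseteq> P"
  shows "card (A - P) \<le> g"
proof -
  obtain Y where Y: "Y \<subseteq> A" "card Y \<le> g" "A - Y \<subseteq> B"
    using assms(1) unfolding has_container_def by blast
  have "card (A - P) \<le> card Y"
    using Y assms(2,3) finite_subset by (intro card_mono) blast+
  with Y(2) show ?thesis by linarith
qed

lemma obtain_small_covering:
  fixes A :: "'a::ab_group_add set"
  assumes "finite A" "A \<noteq> {}" "card (A + A) \<le> m" "m \<le> (card A)\<^sup>2"
  obtains T S where "T \<noteq> {}" "T \<subseteq> A" "S \<subseteq> A" "A \<subseteq> popular_shifts T (S + T)"
    "card T \<le> sqrt m + 1" "card S \<le> 2 * (sqrt m + 1)"
proof -
  define t where "t = nat \<lceil>sqrt m\<rceil>"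
  have t_bounds: "sqrt m \<le> t" "t \<le> sqrt m + 1" unfolding t_def by (auto simp: ceiling_correct)
  have "0 < m" using card_le_card_sumset[OF assms(1)] assms(1-3) card_gt_0_iff[of A] by linarith
  then have "0 < t" by (simp add: t_def)
  have "sqrt m \<le> card A" using real_le_lsqrt[of "card A" m] assms(4) by (simp flip: of_nat_power)
  then have "t \<le> card A" by (simp add: t_def ceiling_le_iff)
  then obtain T where T: "T \<subseteq> A" "card T = t" "finite T" using obtain_subset_with_card_n by blast
  have "card (A + T) \<le> m" using card_sumset_mono[OF assms(1) order_refl T(1)] assms(3) by simp
  then obtain S where S: "S \<subseteq> A" "card T * card S \<le> 2 * m" "A \<subseteq> popular_shifts T (S + T)"
    using obtain_subset_covering_popular[OF assms(1) T(3)] by blast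
  have "real m = sqrt m * sqrt m" by simp
  also have "\<dots> \<le> real t * real t" using t_bounds(1) by (intro mult_mono) auto
  finally have "t * real (card S) \<le> t * (2 * t)"
    using of_nat_mono[OF S(2), where 'a = real] T(2) by simp
  then have "card S \<le> 2 * real t" using \<open>0 < t\<close> by simp
  then have "card S \<le> 2 * (sqrt m + 1)" using t_bounds(2) by simp
  moreover have "T \<noteq> {}" using T(2) \<open>0 < t\<close> by auto
  ultimately show thesis using that T S t_bounds(2) by simp
qed

lemma obtain_container_of_basis:
  fixes A X D :: "'a::ab_group_add set" and \<gamma> \<kappa> :: real
  assumes "0 < \<gamma>" "0 < \<kappa>" "finite X" "A \<subseteq> X" "A \<noteq> {}"
    and card_X_le: "card X \<le> 2 * m" and e_large: "\<kappa> / 2 * m \<le> e" "0 < m"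
    and missing: "card (missing_pairs A D) \<le> \<gamma>\<^sup>2 * \<kappa> / 64 * (card A)\<^sup>2"
  obtains V where "V \<subseteq> A" "card V \<le> 4 / \<kappa>" "card (A - container X D V e) \<le> \<gamma> / 2 * card A"
proof -
  define q where "q = \<gamma> * \<kappa> / 16 * card A"
  have "0 < card A" using assms(3-5) by (simp add: card_gt_0_iff finite_subset)
  then have q_pos: "0 < q" using assms(1,2) by (simp add: q_def)
  obtain V where V: "V \<subseteq> A" "e * card V \<le> card X"
    "card (A - container X D V e) \<le> card (missing_pairs A D) / q + card V * q"
    using obtain_container[OF assms(3,4) q_pos] by blast
  have "\<kappa> / 2 * m * card V \<le> real e * real (card V)"
    using e_large(1) by (intro mult_right_mono) auto
  also have "\<dots> \<le> 2 * real m"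
    using of_nat_mono[OF order_trans[OF V(2) card_X_le], where 'a = real] by simp
  finally have V_le: "card V \<le> 4 / \<kappa>" using assms(2) e_large(2) by (simp add: field_simps)
  have "card (missing_pairs A D) / q \<le> \<gamma>\<^sup>2 * \<kappa> / 64 * (card A)\<^sup>2 / q"
    using missing q_pos by (intro divide_right_mono) auto
  also have "\<dots> = \<gamma> / 4 * card A"
    using assms(1,2) \<open>0 < card A\<close> by (simp add: q_def power2_eq_square)
  finally have "card (missing_pairs A D) / q \<le> \<gamma> / 4 * card A" .
  moreover have "card V * q \<le> 4 / \<kappa> * q" using V_le q_pos by (intro mult_right_mono) auto
  then have "card V * q \<le> \<gamma> / 4 * card A" using assms(2) by (simp add: q_def)
  ultimately have "card (A - container X D V e) \<le> \<gamma> / 2 * card A" using V(3) by linarith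
  with V(1) V_le show thesis by (rule that)
qed

lemma exists_container_of_small_basis:
  fixes A F :: "'a::ab_group_add set" and \<gamma> \<kappa> :: real
  assumes pos: "0 < \<gamma>" "0 < \<kappa>" and A_sumset: "finite A" "A \<noteq> {}" "card (A + A) \<le> m"
    and m_le: "m \<le> (card A)\<^sup>2" and e_large: "\<kappa> / 2 * m \<le> e"
    and \<tau>_large: "2 * (sqrt m + 1) + 4 / \<kappa> \<le> \<tau>"
    and F: "F \<subseteq> A" "card F \<le> \<gamma> / 2 * card A"
      "card (missing_pairs A (F + F)) \<le> \<gamma>\<^sup>2 * \<kappa> / 64 * (card A)\<^sup>2"
  shows "\<exists>B. has_container \<tau> (nat \<lfloor>\<gamma> * card A\<rfloor>) e A B"
proof -
  obtain T S where TS: "T \<noteq> {}" "T \<subseteq> A" "S \<subseteq> A" "A \<subseteq> popular_shifts T (S + T)"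
    "card T \<le> sqrt m + 1" "card S \<le> 2 * (sqrt m + 1)"
    using obtain_small_covering[OF A_sumset m_le] by blast
  let ?X = "popular_shifts T (S + T)"
  have fin: "finite T" "finite S" using TS(2,3) A_sumset(1) finite_subset by blast+
  then have "finite ?X" using TS(1) by (intro finite_popular_shifts finite_set_plus)
  have "card ?X \<le> 2 * card (S + T)"
    using fin TS(1) by (intro card_popular_shifts_le finite_set_plus)
  then have card_X_le: "card ?X \<le> 2 * m"
    using card_sumset_mono[OF A_sumset(1) TS(3,2)] A_sumset(3) by linarith
  have "0 < m" using A_sumset card_le_card_sumset[OF A_sumset(1)] card_gt_0_iff[of A] by linarith
  then obtain V where V: "V \<subseteq> A" "card V \<le> 4 / \<kappa>"
    "card (A - container ?X (F + F) V e) \<le> \<gamma> / 2 * card A"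
    using obtain_container_of_basis[OF pos \<open>finite ?X\<close> TS(4) A_sumset(2) card_X_le e_large _ F(3)]
    by blast
  define Y where "Y = F \<union> (A - container ?X (F + F) V e)"
  have "card Y \<le> card F + card (A - container ?X (F + F) V e)" unfolding Y_def by (rule card_Un_le)
  then have "card Y \<le> \<gamma> * card A" using F(2) V(3) by linarith
  then have "card Y \<le> nat \<lfloor>\<gamma> * card A\<rfloor>" by (simp add: le_nat_iff le_floor_iff)
  moreover have "F \<subseteq> Y" "Y \<subseteq> A" "A - Y \<subseteq> container ?X (F + F) V e" using F(1) by (auto simp: Y_def)
  moreover have "0 \<le> 4 / \<kappa>" "0 \<le> sqrt m" using pos by simp_all
  then have "real (card T) \<le> \<tau>" "real (card S) \<le> \<tau>" "real (card V) \<le> \<tau>"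
    using TS(5,6) V(2) \<tau>_large by argo+
  then have "card T \<le> \<tau>" "card S \<le> \<tau>" "card V \<le> \<tau>" by simp_all
  ultimately show ?thesis using TS V(1) unfolding has_container_def by blast
qed

lemma obtain_container_const:
  fixes \<gamma> \<kappa> :: real
  assumes "0 < \<gamma>" "0 < \<kappa>"
  obtains c :: real where "0 < c"
    "\<And>(A :: 'a::ab_group_add set) m \<tau>.
      \<lbrakk>finite A; A \<noteq> {}; card (A + A) \<le> m; m \<le> c * (card A)\<^sup>2; 2 * (sqrt m + 1) + 4 / \<kappa> \<le> \<tau>\<rbrakk>
      \<Longrightarrow> \<exists>B. has_container \<tau> (nat \<lfloor>\<gamma> * card A\<rfloor>) (nat \<lfloor>\<kappa> * m\<rfloor>) A B"
proof -
  obtain c\<^sub>0 :: real where "0 < c\<^sub>0" and small_basis: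
    "\<And>(A :: 'a set) m. \<lbrakk>finite A; A \<noteq> {}; card (A + A) \<le> m; m \<le> c\<^sub>0 * (card A)\<^sup>2\<rbrakk> \<Longrightarrow>
      \<exists>F\<subseteq>A. card F \<le> \<gamma> / 2 * card A \<and> card (missing_pairs A (F + F)) \<le> \<gamma>\<^sup>2 * \<kappa> / 64 * (card A)\<^sup>2"
    by (rule obtain_small_basis[of "\<gamma> / 2" "\<gamma>\<^sup>2 * \<kappa> / 64"]) (use assms in auto)
  define c where "c = Min {c\<^sub>0, 1, \<kappa> / 2}"
  have c_le: "c \<le> c\<^sub>0" "c \<le> 1" "c \<le> \<kappa> / 2" by (simp_all add: c_def)
  have "\<exists>B. has_container \<tau> (nat \<lfloor>\<gamma> * card A\<rfloor>) (nat \<lfloor>\<kappa> * m\<rfloor>) A B"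
    if A_sumset: "finite A" "A \<noteq> {}" "card (A + A) \<le> m" and m_le: "m \<le> c * (card A)\<^sup>2"
      and \<tau>_large: "2 * (sqrt m + 1) + 4 / \<kappa> \<le> \<tau>" for A :: "'a set" and m \<tau>
  proof -
    let ?s = "card A"
    have s_bounds: "0 < ?s" "real ?s \<le> m"
      using A_sumset card_le_card_sumset[OF A_sumset(1)] by (simp_all add: card_gt_0_iff)
    have m_le_mult: "m \<le> d * ?s\<^sup>2" if "c \<le> d" for d :: real
      using m_le mult_right_mono[OF that, of "real (?s\<^sup>2)"] by simp
    have "?s * 1 \<le> \<kappa> / 2 * ?s\<^sup>2" using s_bounds(2) m_le_mult[OF c_le(3)] by simp
    then have "1 \<le> \<kappa> / 2 * ?s" using s_bounds(1) by (simp add: power2_eq_square)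
    also have "\<dots> \<le> \<kappa> / 2 * m" using s_bounds(2) assms(2) by (intro mult_left_mono) auto
    finally have e_large: "\<kappa> / 2 * m \<le> nat \<lfloor>\<kappa> * m\<rfloor>" by linarith
    have "m \<le> ?s\<^sup>2" using m_le_mult[OF c_le(2)] by (simp flip: of_nat_power)
    then show ?thesis
      using exists_container_of_small_basis[OF assms A_sumset _ e_large \<tau>_large]
        small_basis[OF A_sumset m_le_mult[OF c_le(1)]]
      by blast
  qed
  moreover have "0 < c" using assms \<open>0 < c\<^sub>0\<close> by (simp add: c_def)
  ultimately show thesis by (intro that[of c])
qed

section \<open>Counting\<close>

lemma card_subsets_le_power:
  assumes "finite E"
  shows "card {T. T \<subseteq> E \<and> card T \<le> \<tau>} \<le> (card E + 1) ^ \<tau>"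
proof -
  let ?L = "{xs. set xs \<subseteq> insert None (Some ` E) \<and> length xs = \<tau>}"
  have "{T. T \<subseteq> E \<and> card T \<le> \<tau>} \<subseteq> (\<lambda>xs. {x. Some x \<in> set xs}) ` ?L"
  proof clarify
    fix T assume T: "T \<subseteq> E" "card T \<le> \<tau>"
    then obtain xs where "set xs = T" "distinct xs"
      using assms finite_distinct_list finite_subset by metis
    then show "T \<in> (\<lambda>xs. {x. Some x \<in> set xs}) ` ?L"
      using T distinct_card[of xs]
      by (intro image_eqI[of _ _ "map Some xs @ replicate (\<tau> - card T) None"]) auto
  qed
  then have "card {T. T \<subseteq> E \<and> card T \<le> \<tau>} \<le> card ?L"
    using assms by (intro surj_card_le[of ?L]) (simp_all add: finite_lists_length_eq)
  also have "\<dots> = (card E + 1) ^ \<tau>" using assms by (simp add: card_lists_length_eq card_image)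
  finally show ?thesis .
qed

lemma card_UN_le_mult:
  assumes "finite I" "\<And>i. i \<in> I \<Longrightarrow> card (f i) \<le> b"
  shows "card (\<Union>i\<in>I. f i) \<le> card I * b"
  using card_UN_le[OF assms(1)] sum_bounded_above[of I "\<lambda>i. card (f i)" b] assms(2)
  by (metis of_nat_id order_trans)

lemma card_supersets_within_le:
  assumes "finite Y" "finite Z" "card Z \<le> b"
  shows "card {A. Y \<subseteq> A \<and> A - Y \<subseteq> Z \<and> card A = s} \<le> b choose (s - card Y)"
proof -
  let ?\<A> = "{A. Y \<subseteq> A \<and> A - Y \<subseteq> Z \<and> card A = s}"
  have "card ?\<A> \<le> card {W. W \<subseteq> Z \<and> card W = s - card Y}"
  proof (rule card_inj_on_le)
    show "inj_on (\<lambda>A. A - Y) ?\<A>" by (rule inj_onI) blast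
    show "(\<lambda>A. A - Y) ` ?\<A> \<subseteq> {W. W \<subseteq> Z \<and> card W = s - card Y}"
      using assms(1) by (auto simp: card_Diff_subset)
    show "finite {W. W \<subseteq> Z \<and> card W = s - card Y}"
      by (rule finite_subset[of _ "Pow Z"]) (use assms(2) in auto)
  qed
  also have "\<dots> \<le> b choose (s - card Y)"
    using assms(2,3) by (simp add: n_subsets binomial_right_mono)
  finally show "card ?\<A> \<le> b choose (s - card Y)" .
qed

lemma card_supersets_almost_within_le:
  fixes C :: "'a set \<Rightarrow> 'a set" and s b :: nat
  assumes "finite Y" "\<And>F. finite (C F)"
  defines "\<A> \<equiv> {A. Y \<subseteq> A \<and> card A = s \<and> (\<exists>F\<subseteq>Y. A - Y \<subseteq> C F \<and> card (C F) \<le> b)}"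
  shows "finite \<A>" and "card \<A> \<le> 2 ^ card Y * (b choose (s - card Y))"
proof -
  define \<F> where "\<F> = {F \<in> Pow Y. card (C F) \<le> b}"
  have \<F>: "finite \<F>" "card \<F> \<le> 2 ^ card Y"
    using assms(1) card_mono[of "Pow Y" \<F>] by (auto simp: \<F>_def card_Pow)
  have \<A>: "\<A> = (\<Union>F\<in>\<F>. {A. Y \<subseteq> A \<and> A - Y \<subseteq> C F \<and> card A = s})"
    by (auto simp: \<A>_def \<F>_def)
  have "\<A> \<subseteq> Pow (Y \<union> (\<Union>F\<in>Pow Y. C F))" by (auto simp: \<A>_def)
  then show "finite \<A>" by (rule finite_subset) (use assms(1,2) in auto)
  have "card \<A> \<le> card \<F> * (b choose (s - card Y))"
    unfolding \<A> using \<F>(1) assms(1,2)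
    by (intro card_UN_le_mult card_supersets_within_le) (auto simp: \<F>_def)
  also have "\<dots> \<le> 2 ^ card Y * (b choose (s - card Y))" using \<F>(2) by (rule mult_right_mono) simp
  finally show "card \<A> \<le> 2 ^ card Y * (b choose (s - card Y))" .
qed

definition almost_contained :: "'a set \<Rightarrow> ('a set \<Rightarrow> 'a set) \<Rightarrow> nat \<Rightarrow> nat \<Rightarrow> nat \<Rightarrow> 'a set set" where
  "almost_contained X C s g b = {A. A \<subseteq> X \<and> card A = s \<and>
    (\<exists>Y F. F \<subseteq> Y \<and> Y \<subseteq> A \<and> card Y \<le> g \<and> A - Y \<subseteq> C F \<and> card (C F) \<le> b)}"

lemma finite_almost_contained: "finite X \<Longrightarrow> finite (almost_contained X C s g b)"
  by (rule finite_subset[of _ "Pow X"]) (auto simp: almost_contained_def)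

lemma card_almost_contained_le:
  assumes "finite X" "card X \<le> M" and C: "\<And>F. C F \<subseteq> X"
  shows "card (almost_contained X C s g b) \<le> (\<Sum>y\<le>g. 2 ^ y * ((M choose y) * (b choose (s - y))))"
proof -
  define \<Y> where "\<Y> y = {Y. Y \<subseteq> X \<and> card Y = y}" for y
  define \<A> where "\<A> Y = {A. Y \<subseteq> A \<and> card A = s \<and> (\<exists>F\<subseteq>Y. A - Y \<subseteq> C F \<and> card (C F) \<le> b)}" for Y
  have \<Y>: "finite (\<Y> y)" "card (\<Y> y) \<le> M choose y" for y
    unfolding \<Y>_def using assms(1,2) by (simp_all add: n_subsets binomial_right_mono)
  have \<A>: "finite (\<A> Y)" "card (\<A> Y) \<le> 2 ^ y * (b choose (s - y))" if "Y \<in> \<Y> y" for Y y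
  proof -
    have "finite Y" "card Y = y" using that assms(1) finite_subset by (auto simp: \<Y>_def)
    then show "finite (\<A> Y)" "card (\<A> Y) \<le> 2 ^ y * (b choose (s - y))"
      unfolding \<A>_def
        using card_supersets_almost_within_le[of Y C] finite_subset[OF C assms(1)] by blast+
  qed
  have level: "card (\<Union>Y\<in>\<Y> y. \<A> Y) \<le> 2 ^ y * ((M choose y) * (b choose (s - y)))" for y
  proof -
    have "card (\<Union>Y\<in>\<Y> y. \<A> Y) \<le> card (\<Y> y) * (2 ^ y * (b choose (s - y)))"
      using \<Y>(1) \<A>(2) by (rule card_UN_le_mult)
    also have "\<dots> \<le> (M choose y) * (2 ^ y * (b choose (s - y)))"
      using \<Y>(2) by (rule mult_right_mono) simp
    finally show ?thesis by (simp only: mult.left_commute)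
  qed
  have "almost_contained X C s g b \<subseteq> (\<Union>y\<le>g. \<Union>Y\<in>\<Y> y. \<A> Y)"
  proof
    fix A assume "A \<in> almost_contained X C s g b"
    then obtain Y where "Y \<subseteq> X" "card Y \<le> g" "A \<in> \<A> Y"
      unfolding almost_contained_def \<A>_def by blast
    then show "A \<in> (\<Union>y\<le>g. \<Union>Y\<in>\<Y> y. \<A> Y)" by (auto simp: \<Y>_def)
  qed
  then have "card (almost_contained X C s g b) \<le> card (\<Union>y\<le>g. \<Union>Y\<in>\<Y> y. \<A> Y)"
    using \<Y>(1) \<A>(1) by (intro card_mono finite_UN_I) auto
  also have "\<dots> \<le> (\<Sum>y\<le>g. card (\<Union>Y\<in>\<Y> y. \<A> Y))" by (rule card_UN_le) simp
  also have "\<dots> \<le> (\<Sum>y\<le>g. 2 ^ y * ((M choose y) * (b choose (s - y))))" by (intro sum_mono level)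
  finally show ?thesis .
qed

definition container_seeds ::
  "'a::ab_group_add set \<Rightarrow> nat \<Rightarrow> nat \<Rightarrow> ('a set \<times> 'a set \<times> 'a set) set" where
  "container_seeds E \<tau> m = {(T, S, V). T \<noteq> {} \<and> T \<subseteq> E \<and> S \<subseteq> E \<and> V \<subseteq> E \<and>
    card T \<le> \<tau> \<and> card S \<le> \<tau> \<and> card V \<le> \<tau> \<and> card (popular_shifts T (S + T)) \<le> 2 * m}"

lemma card_container_seeds_le:
  assumes "finite E"
  shows "finite (container_seeds E \<tau> m)" "card (container_seeds E \<tau> m) \<le> (card E + 1) ^ (3 * \<tau>)"
proof -
  let ?\<P> = "{T. T \<subseteq> E \<and> card T \<le> \<tau>}"
  have "finite ?\<P>" by (rule finite_subset[of _ "Pow E"]) (use assms in auto)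
  then have fin: "finite (?\<P> \<times> ?\<P> \<times> ?\<P>)" by simp
  have sub: "container_seeds E \<tau> m \<subseteq> ?\<P> \<times> ?\<P> \<times> ?\<P>" by (auto simp: container_seeds_def)
  show "finite (container_seeds E \<tau> m)" by (rule finite_subset[OF sub fin])
  have "card (container_seeds E \<tau> m) \<le> card ?\<P> * (card ?\<P> * card ?\<P>)"
    using card_mono[OF fin sub] by (simp only: card_cartesian_product)
  also have "\<dots> \<le> (card E + 1) ^ \<tau> * ((card E + 1) ^ \<tau> * (card E + 1) ^ \<tau>)"
    by (intro mult_le_mono card_subsets_le_power[OF assms])
  also have "\<dots> = (card E + 1) ^ (3 * \<tau>)" by (simp add: mult.commute[of 3] power_mult power3_eq_cube)
  finally show "card (container_seeds E \<tau> m) \<le> (card E + 1) ^ (3 * \<tau>)" .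
qed

definition container_family ::
  "nat \<Rightarrow> nat \<Rightarrow> nat \<Rightarrow> nat \<Rightarrow> 'a::ab_group_add set \<times> 'a set \<times> 'a set \<Rightarrow> 'a set set" where
  "container_family s g e b = (\<lambda>(T, S, V). let X = popular_shifts T (S + T) in
     almost_contained X (\<lambda>F. container X (F + F) V e) s g b)"

lemma has_small_container_in_family:
  assumes "finite A" "A \<subseteq> E" "card (A + A) \<le> m" "has_container \<tau> g e A B" "card B \<le> b"
  shows "\<exists>q\<in>container_seeds E \<tau> m. A \<in> container_family (card A) g e b q"
proof -
  obtain T S V Y F where container: "T \<noteq> {}" "T \<subseteq> A" "S \<subseteq> A" "V \<subseteq> A"
    "card T \<le> \<tau>" "card S \<le> \<tau>" "card V \<le> \<tau>"
    "F \<subseteq> Y" "Y \<subseteq> A" "card Y \<le> g" "A \<subseteq> popular_shifts T (S + T)"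
    "B = container (popular_shifts T (S + T)) (F + F) V e" "A - Y \<subseteq> B"
    using assms(4) unfolding has_container_def by blast
  have fin: "finite T" "finite S" using container(2,3) assms(1) finite_subset by blast+
  have "card (popular_shifts T (S + T)) \<le> 2 * card (S + T)"
    using container(1) fin by (intro card_popular_shifts_le finite_set_plus)
  also have "\<dots> \<le> 2 * m" using card_sumset_mono[OF assms(1) container(3,2)] assms(3) by simp
  finally have "(T, S, V) \<in> container_seeds E \<tau> m"
    using container(1-7) assms(2) by (auto simp: container_seeds_def)
  moreover have "A \<in> container_family (card A) g e b (T, S, V)"
    using assms(5) container(8-13) unfolding container_family_def almost_contained_def
    by (auto simp: Let_def)
  ultimately show ?thesis by blast
qed

lemma card_container_family_le:
  assumes "finite E" "q \<in> container_seeds E \<tau> m"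
  shows "finite (container_family s g e b q)"
    and "card (container_family s g e b q) \<le> (\<Sum>y\<le>g. 2 ^ y * ((2 * m choose y) * (b choose (s - y))))"
proof -
  obtain T S V where q_eq: "q = (T, S, V)" by (cases q) auto
  let ?X = "popular_shifts T (S + T)"
  have "T \<noteq> {}" "finite T" "finite S" and card_X_le: "card ?X \<le> 2 * m"
    using assms finite_subset by (auto simp: container_seeds_def q_eq)
  then have fin: "finite ?X" by (intro finite_popular_shifts finite_set_plus)
  have "container_family s g e b q = almost_contained ?X (\<lambda>F. container ?X (F + F) V e) s g b"
    by (simp add: container_family_def q_eq Let_def)
  then show "finite (container_family s g e b q)"
    and "card (container_family s g e b q) \<le> (\<Sum>y\<le>g. 2 ^ y * ((2 * m choose y) * (b choose (s - y))))"
    using finite_almost_contained[OF fin] card_almost_contained_le[OF fin card_X_le container_subset]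
    by simp_all
qed

lemma card_has_small_container_le:
  assumes "finite E"
    and "\<And>A. A \<in> \<A> \<Longrightarrow> A \<subseteq> E \<and> card A = s \<and> card (A + A) \<le> m \<and>
      (\<exists>B. has_container \<tau> g e A B \<and> card B \<le> b)"
  shows "card \<A> \<le> (card E + 1) ^ (3 * \<tau>) * (\<Sum>y\<le>g. 2 ^ y * ((2 * m choose y) * (b choose (s - y))))"
    (is "_ \<le> _ * ?w")
proof -
  let ?Q = "container_seeds E \<tau> m"
  have "\<A> \<subseteq> (\<Union>q\<in>?Q. container_family s g e b q)"
  proof
    fix A assume "A \<in> \<A>"
    then obtain B where "A \<subseteq> E" "card A = s" "card (A + A) \<le> m"
      "has_container \<tau> g e A B" "card B \<le> b"
      using assms(2) by blast
    then show "A \<in> (\<Union>q\<in>?Q. container_family s g e b q)"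
      using has_small_container_in_family[of A E m \<tau> g e B b] assms(1) finite_subset by auto
  qed
  then have "card \<A> \<le> card (\<Union>q\<in>?Q. container_family s g e b q)"
    by (rule card_mono[rotated])
      (use card_container_seeds_le(1)[OF assms(1)] card_container_family_le(1)[OF assms(1)] in auto)
  also have "\<dots> \<le> card ?Q * ?w"
    by (intro card_UN_le_mult card_container_seeds_le(1) card_container_family_le(2))
      (use assms(1) in auto)
  also have "\<dots> \<le> (card E + 1) ^ (3 * \<tau>) * ?w"
    by (intro mult_right_mono card_container_seeds_le(2)[OF assms(1)]) simp
  finally show ?thesis .
qed

lemma binomial_le_power_mult:
  fixes b b' j :: nat and r :: real
  assumes "\<And>i. i < j \<Longrightarrow> real b - real i \<le> r * (real b' - real i)" "0 \<le> r"
  shows "real (b choose j) \<le> r ^ j * real (b' choose j)"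
proof (cases "j \<le> b")
  case True
  have "(\<Prod>i=0..<j. real b - real i) \<le> (\<Prod>i=0..<j. r * (real b' - real i))"
    using True assms(1) by (intro prod_mono) auto
  also have "\<dots> = r ^ j * (\<Prod>i=0..<j. real b' - real i)" by (simp add: prod.distrib)
  finally show ?thesis
    by (simp add: binomial_gbinomial gbinomial_prod_rev divide_right_mono)
next
  case False
  then show ?thesis using assms(2) by (simp add: binomial_eq_0)
qed

lemma binomial_mult_binomial_le:
  assumes "y \<le> s" "q \<le> k"
  shows "(q choose y) * (k - q choose (s - y)) \<le> k choose s"
proof -
  have "(q choose y) * (k - q choose (s - y)) \<le> (\<Sum>j\<le>s. (q choose j) * (k - q choose (s - j)))"
    using assms(1) by (intro member_le_sum[of y _ "\<lambda>j. (q choose j) * (k - q choose (s - j))"]) auto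
  also have "\<dots> = k choose s" using vandermonde[of q "k - q" s] assms(2) by simp
  finally show ?thesis .
qed

text \<open>A small part of size \<open>q\<close> of the \<open>k\<close> points is enough for the \<open>y\<close> elements chosen from \<open>M\<close>
  points; shrinking the room for the other \<open>s - y\<close> elements by the factor \<open>r\<close> gains \<open>r ^ (s - y)\<close>.\<close>

lemma binomial_product_le:
  fixes b k q s y M :: nat and r :: real
  assumes "y \<le> s" "2 * y \<le> q" "0 < q" "q \<le> k" "0 \<le> r" "r \<le> 1" "real b \<le> r * (real k - real q)"
  shows "real (M choose y) * real (b choose (s - y))
    \<le> (2 * real M / real q) ^ y * r ^ (s - y) * real (k choose s)"
proof -
  have "real (M choose y) \<le> (2 * real M / real q) ^ y * real (q choose y)"
  proof (rule binomial_le_power_mult)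
    fix i assume "i < y"
    then have "real q \<le> 2 * (real q - real i)" using assms(2) by simp
    then have "real M * q \<le> M * (2 * (real q - real i))" by (intro mult_left_mono) auto
    then have "real M \<le> 2 * real M / real q * (real q - real i)"
      using assms(3) by (simp add: field_simps)
    then show "real M - real i \<le> 2 * real M / real q * (real q - real i)" by simp
  qed simp
  moreover have "real (b choose (s - y)) \<le> r ^ (s - y) * real (k - q choose (s - y))"
  proof (rule binomial_le_power_mult)
    fix i
    have "r * i \<le> 1 * real i" using assms by (intro mult_right_mono) auto
    then show "real b - real i \<le> r * (real (k - q) - real i)"
      using assms by (simp add: of_nat_diff algebra_simps)
  qed (use assms in simp)
  ultimately have "real (M choose y) * real (b choose (s - y))
    \<le> ((2 * real M / real q) ^ y * real (q choose y)) * (r ^ (s - y) * real (k - q choose (s - y)))"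
    by (intro mult_mono) auto
  also have "\<dots> = (2 * real M / real q) ^ y * r ^ (s - y) * real ((q choose y) * (k - q choose (s - y)))"
    by simp
  also have "\<dots> \<le> (2 * real M / real q) ^ y * r ^ (s - y) * real (k choose s)"
    using assms by (intro mult_left_mono of_nat_mono binomial_mult_binomial_le) auto
  finally show ?thesis .
qed

lemma container_weight_le_power:
  fixes \<kappa> :: real and b k m s y :: nat
  assumes \<kappa>_bounds: "0 < \<kappa>" "\<kappa> \<le> 1 / 9" and k_bounds: "1 \<le> \<kappa> * k" "m \<le> 2 * k"
    and b_le: "b \<le> (1 - 3 * \<kappa>) * k"
    and y_bounds: "y \<le> s" "2 * y \<le> \<kappa> * k"
  shows "2 ^ y * (real (2 * m choose y) * real (b choose (s - y)))
    \<le> (32 / \<kappa>) ^ y * (1 - \<kappa>) ^ s * real (k choose s)"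
proof -
  define q where "q = nat \<lceil>\<kappa> * k\<rceil>"
  have q_bounds: "\<kappa> * k \<le> q" "q \<le> 2 * (\<kappa> * k)" using k_bounds(1) unfolding q_def by linarith+
  then have "0 < q" "2 * y \<le> q" using k_bounds(1) y_bounds(2) by linarith+
  have "\<kappa> * k \<le> 1 / 9 * k" using \<kappa>_bounds by (intro mult_right_mono) auto
  then have "q \<le> k" using q_bounds by linarith
  have "(1 - 3 * \<kappa>) * k \<le> (1 - \<kappa>) * (real k - 2 * (\<kappa> * k))"
    using \<kappa>_bounds by (simp add: algebra_simps)
  also have "\<dots> \<le> (1 - \<kappa>) * (real k - real q)" using \<kappa>_bounds q_bounds by (intro mult_left_mono) auto
  finally have "real (2 * m choose y) * real (b choose (s - y))
      \<le> (2 * real (2 * m) / q) ^ y * (1 - \<kappa>) ^ (s - y) * real (k choose s)"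
    using b_le \<open>2 * y \<le> q\<close> \<open>0 < q\<close> \<open>q \<le> k\<close> y_bounds(1) \<kappa>_bounds by (intro binomial_product_le) auto
  then have "2 ^ y * (real (2 * m choose y) * real (b choose (s - y)))
      \<le> 2 ^ y * ((2 * real (2 * m) / q) ^ y * (1 - \<kappa>) ^ (s - y) * real (k choose s))"
    by (intro mult_left_mono) auto
  also have "\<dots> = (8 * real m / q) ^ y * (1 - \<kappa>) ^ (s - y) * real (k choose s)"
    by (simp flip: power_mult_distrib)
  also have "\<dots> \<le> ((32 / \<kappa>) * (1 - \<kappa>)) ^ y * (1 - \<kappa>) ^ (s - y) * real (k choose s)"
  proof (intro mult_right_mono power_mono)
    have "8 * real m / q \<le> 8 * (2 * real k) / (\<kappa> * k)"
      using k_bounds q_bounds by (intro frac_le) auto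
    also have "\<dots> = 16 / \<kappa>" using k_bounds(1) by auto
    also have "\<dots> \<le> 32 / \<kappa> * (1 - \<kappa>)" using \<kappa>_bounds by (simp add: field_simps)
    finally show "8 * real m / q \<le> 32 / \<kappa> * (1 - \<kappa>)" .
  qed (use \<kappa>_bounds in auto)
  also have "\<dots> = (32 / \<kappa>) ^ y * ((1 - \<kappa>) ^ y * (1 - \<kappa>) ^ (s - y)) * real (k choose s)"
    by (simp only: power_mult_distrib mult.assoc)
  also have "(1 - \<kappa>) ^ y * (1 - \<kappa>) ^ (s - y) = (1 - \<kappa>) ^ s"
    using y_bounds(1) by (simp flip: power_add)
  finally show ?thesis .
qed

lemma power_mult_power_le_exp:
  fixes \<kappa> :: real and s y :: nat
  assumes \<kappa>_bounds: "0 < \<kappa>" "\<kappa> \<le> 1" and y_le: "y \<le> (\<kappa> / 16)\<^sup>2 * s"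
  shows "(32 / \<kappa>) ^ y * (1 - \<kappa>) ^ s \<le> exp (- (7 / 8 * (\<kappa> * s)))"
proof -
  have "(32 / \<kappa>) ^ y \<le> exp (32 / \<kappa>) ^ y"
    using \<kappa>_bounds less_imp_le[OF exp_gt_self[of "32 / \<kappa>"]] by (intro power_mono) auto
  also have "\<dots> = exp (y * (32 / \<kappa>))" by (simp flip: exp_of_nat_mult)
  also have "\<dots> \<le> exp ((\<kappa> / 16)\<^sup>2 * s * (32 / \<kappa>))"
    using y_le \<kappa>_bounds by (intro iffD2[OF exp_le_cancel_iff] mult_right_mono) auto
  also have "(\<kappa> / 16)\<^sup>2 * s * (32 / \<kappa>) = \<kappa> * s / 8" using \<kappa>_bounds by (simp add: power2_eq_square)
  finally have fst_le_exp: "(32 / \<kappa>) ^ y \<le> exp (\<kappa> * s / 8)" .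
  have "(1 - \<kappa>) ^ s \<le> exp (- \<kappa>) ^ s"
    using \<kappa>_bounds exp_ge_add_one_self[of "- \<kappa>"] by (intro power_mono) auto
  also have "\<dots> = exp (- (\<kappa> * s))" by (simp add: exp_of_nat_mult[symmetric] mult.commute)
  finally have "(32 / \<kappa>) ^ y * (1 - \<kappa>) ^ s \<le> exp (\<kappa> * s / 8) * exp (- (\<kappa> * s))"
    using \<kappa>_bounds fst_le_exp by (intro mult_mono) auto
  also have "\<dots> = exp (- (7 / 8 * (\<kappa> * s)))" by (simp flip: exp_add)
  finally show ?thesis .
qed

lemma sum_container_weight_le:
  fixes \<kappa> :: real and b g k m s :: nat
  assumes \<kappa>_bounds: "0 < \<kappa>" "\<kappa> \<le> 1 / 9" and k_bounds: "1 \<le> \<kappa> * k" "s \<le> 2 * k" "m \<le> 2 * k"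
    and b_le: "b \<le> (1 - 3 * \<kappa>) * k" and g_le: "g \<le> (\<kappa> / 16)\<^sup>2 * s"
  shows "(\<Sum>y\<le>g. 2 ^ y * (real (2 * m choose y) * real (b choose (s - y))))
    \<le> exp (- (3 / 4 * (\<kappa> * s))) * real (k choose s)"
proof -
  have \<kappa>_square_le: "(\<kappa> / 16)\<^sup>2 \<le> \<kappa> / 256"
    using \<kappa>_bounds power2_le_mult[of \<kappa> 1] by (simp add: power_divide)
  have g_le_\<kappa>: "g \<le> \<kappa> / 256 * s" using g_le mult_right_mono[OF \<kappa>_square_le, of "real s"] by simp
  have "(\<Sum>y\<le>g. 2 ^ y * (real (2 * m choose y) * real (b choose (s - y))))
      \<le> (\<Sum>y\<le>g. exp (- (7 / 8 * (\<kappa> * s))) * real (k choose s))"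
  proof (rule sum_mono)
    fix y assume "y \<in> {..g}"
    then have y_le_g: "y \<le> g" by simp
    have "\<kappa> * s \<le> 1 / 9 * s" using \<kappa>_bounds by (intro mult_right_mono) auto
    moreover have "\<kappa> * s \<le> \<kappa> * real (2 * k)"
      using \<kappa>_bounds k_bounds(2) by (intro mult_left_mono) auto
    ultimately have "y \<le> s" "2 * y \<le> \<kappa> * k" using y_le_g g_le_\<kappa> k_bounds(1) by auto
    then have "2 ^ y * (real (2 * m choose y) * real (b choose (s - y)))
        \<le> (32 / \<kappa>) ^ y * (1 - \<kappa>) ^ s * real (k choose s)"
      using \<kappa>_bounds k_bounds(1,3) b_le by (intro container_weight_le_power)
    also have "\<dots> \<le> exp (- (7 / 8 * (\<kappa> * s))) * real (k choose s)"
      using \<kappa>_bounds y_le_g g_le by (intro mult_right_mono power_mult_power_le_exp) auto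
    finally show "2 ^ y * (real (2 * m choose y) * real (b choose (s - y)))
        \<le> exp (- (7 / 8 * (\<kappa> * s))) * real (k choose s)" .
  qed
  also have "\<dots> = (1 + real g) * (exp (- (7 / 8 * (\<kappa> * s))) * real (k choose s))" by simp
  also have "\<dots> \<le> exp (\<kappa> * s / 8) * (exp (- (7 / 8 * (\<kappa> * s))) * real (k choose s))"
  proof (intro mult_right_mono)
    have "1 + real g \<le> 1 + \<kappa> * s / 8" using g_le_\<kappa> \<kappa>_bounds by simp
    also have "\<dots> \<le> exp (\<kappa> * s / 8)" by (rule exp_ge_add_one_self)
    finally show "1 + real g \<le> exp (\<kappa> * s / 8)" .
  qed auto
  also have "\<dots> = exp (- (3 / 4 * (\<kappa> * s))) * real (k choose s)"
    by (simp add: mult.assoc[symmetric] flip: exp_add)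
  finally show ?thesis .
qed

lemma power_le_exp_log:
  fixes n :: nat
  assumes n_ge_2: "2 \<le> n"
  shows "(real n + 1) ^ (3 * \<tau>) \<le> exp (6 * (\<tau> * log 2 n))"
proof -
  have "2 * real n \<le> real n * real n" using n_ge_2 by (intro mult_right_mono) auto
  then have "real n + 1 \<le> real n * real n" using n_ge_2 by linarith
  then have "ln (real n + 1) \<le> ln (real n * real n)" using n_ge_2 by simp
  also have "\<dots> = 2 * ln (real n)" using n_ge_2 by (simp add: ln_mult)
  also have "ln (real n) = log 2 n * ln 2" using n_ge_2 by (simp add: log_def)
  also have "\<dots> \<le> log 2 n * 1" using n_ge_2 ln_2_less_1 by (intro mult_left_mono) auto
  finally have ln_n: "ln (real n + 1) \<le> 2 * log 2 n" by simp
  have "(real n + 1) ^ (3 * \<tau>) = exp (real (3 * \<tau>) * ln (real n + 1))"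
    by (subst exp_of_nat_mult) simp
  also have "\<dots> \<le> exp (real (3 * \<tau>) * (2 * log 2 n))"
    using ln_n by (subst exp_le_cancel_iff, intro mult_left_mono) auto
  finally show ?thesis by (simp add: mult_ac)
qed

lemma le_mult_of_mult_square_le:
  fixes L m s \<delta> :: real
  assumes "1 \<le> L" "0 < s" "s \<le> m" "m * L\<^sup>2 \<le> \<delta> * s\<^sup>2"
  shows "L \<le> \<delta> * s"
proof -
  have "s * L\<^sup>2 \<le> m * L\<^sup>2" using assms(3) by (intro mult_right_mono) auto
  with assms(4) have "s * L\<^sup>2 \<le> s * (\<delta> * s)" by (simp add: power2_eq_square mult_ac)
  then have "L\<^sup>2 \<le> \<delta> * s" using assms(2) by simp
  moreover have "L \<le> L\<^sup>2" using assms(1) by (simp add: power2_eq_square mult_le_cancel_right1)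
  ultimately show ?thesis by linarith
qed

lemma seed_cost_le:
  fixes \<kappa> L m s \<tau> :: real
  assumes \<kappa>_bounds: "0 < \<kappa>" "\<kappa> \<le> 1 / 9" and L_ge_1: "1 \<le> L" and s_bounds: "0 < s" "s \<le> m"
    and m_le: "m * L\<^sup>2 \<le> (\<kappa> / 200)\<^sup>2 * s\<^sup>2" and \<tau>_le: "\<tau> \<le> 2 * (sqrt m + 1) + 4 / \<kappa> + 1"
  shows "6 * (\<tau> * L) \<le> \<kappa> * s / 8"
proof -
  have L_le: "L \<le> (\<kappa> / 200)\<^sup>2 * s" by (rule le_mult_of_mult_square_le[OF L_ge_1 s_bounds m_le])
  have "(sqrt m * L)\<^sup>2 \<le> (\<kappa> / 200 * s)\<^sup>2"
    using m_le s_bounds by (simp add: power_mult_distrib power_divide)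
  then have sqrt_le: "sqrt m * L \<le> \<kappa> / 200 * s"
    by (rule power2_le_imp_le) (use \<kappa>_bounds s_bounds in simp)
  have "(3 + 4 / \<kappa>) * L \<le> (3 + 4 / \<kappa>) * ((\<kappa> / 200)\<^sup>2 * s)"
    using L_le \<kappa>_bounds by (intro mult_left_mono) auto
  also have "\<dots> = (3 * \<kappa> + 4) / 40000 * (\<kappa> * s)"
    using \<kappa>_bounds by (simp add: field_simps power2_eq_square)
  also have "\<dots> \<le> 5 / 40000 * (\<kappa> * s)" using \<kappa>_bounds s_bounds by (intro mult_right_mono) auto
  finally have const_le: "(3 + 4 / \<kappa>) * L \<le> 5 / 40000 * (\<kappa> * s)" .
  have "\<tau> * L \<le> (2 * (sqrt m + 1) + 4 / \<kappa> + 1) * L"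
    using \<tau>_le L_ge_1 by (intro mult_right_mono) auto
  also have "\<dots> = 2 * (sqrt m * L) + (3 + 4 / \<kappa>) * L" by (simp add: algebra_simps)
  also have "\<dots> \<le> \<kappa> * s / 48"
    using sqrt_le const_le mult_pos_pos[OF \<kappa>_bounds(1) s_bounds(1)] by linarith
  finally show ?thesis by simp
qed

section \<open>Sets of small doubling\<close>

definition near_progression :: "real \<Rightarrow> nat \<Rightarrow> nat \<Rightarrow> int set set" where
  "near_progression \<eta> s m = {A. \<exists>P. arith_prog P \<and> real (card P) \<le> real m / 2 + \<eta> * real m \<and>
     real (card (A - P)) \<le> \<eta> * real s}"

lemma finite_small_doubling: "finite (small_doubling n s m)"
  by (rule finite_subset[of _ "Pow {1..int n}"]) (auto simp: small_doubling_def)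

lemma small_doubling_imp_le: "A \<in> small_doubling n s m \<Longrightarrow> s \<le> m"
  using card_le_card_sumset[of A] finite_subset[of A "{1..int n}"]
  by (auto simp: small_doubling_def)

lemma binomial_le_card_small_doubling:
  assumes "k \<le> n" "2 * k \<le> m + 1"
  shows "k choose s \<le> card (small_doubling n s m)"
proof -
  have "{A. A \<subseteq> {1..int k} \<and> card A = s} \<subseteq> small_doubling n s m"
  proof clarify
    fix A :: "int set" assume A_subset: "A \<subseteq> {1..int k}"
    have "A + A \<subseteq> {2..2 * int k}"
    proof
      fix z assume "z \<in> A + A"
      then obtain x y where "x \<in> A" "y \<in> A" "z = x + y" by (rule set_plus_elim)
      moreover from this A_subset have "x \<in> {1..int k}" "y \<in> {1..int k}" by blast+
      ultimately show "z \<in> {2..2 * int k}" by simp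
    qed
    then have "card (A + A) \<le> card {2..2 * int k}" by (intro card_mono) auto
    also have "\<dots> \<le> m" using assms(2) by simp
    finally show "A \<in> small_doubling n (card A) m"
      using A_subset assms(1) by (auto simp: small_doubling_def)
  qed
  then have "card {A. A \<subseteq> {1..int k} \<and> card A = s} \<le> card (small_doubling n s m)"
    using finite_small_doubling by (rule card_mono[rotated])
  then show ?thesis by (simp add: n_subsets)
qed

lemma small_doubling_subset_near_progression:
  assumes "1 \<le> n" "2 * n \<le> m" "0 \<le> \<eta>"
  shows "small_doubling n s m \<subseteq> near_progression \<eta> s m"
proof
  fix A assume "A \<in> small_doubling n s m"
  then have "A - {1..int n} = {}" by (auto simp: small_doubling_def)
  then have "real (card (A - {1..int n})) \<le> \<eta> * s"
    using assms(3) by (simp only: card.empty) simp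
  moreover have "{x \<in> {1..1 + int (n - 1) * 1}. 1 dvd x - 1} = {1..int n}"
    using assms(1) by (auto simp: of_nat_diff)
  then have "arith_prog {1..int n}" using arith_prog_residue_class_interval[of 1 1 "n - 1"] by simp
  moreover have "real (card {1..int n}) \<le> m / 2 + \<eta> * m"
    using assms(2,3) by (simp add: add_increasing2)
  ultimately show "A \<in> near_progression \<eta> s m" unfolding near_progression_def by blast
qed

lemma has_large_container_near_progression:
  fixes A B :: "int set" and \<eta> \<kappa> :: real
  assumes \<eta>_bounds: "0 < \<eta>" "\<eta> \<le> 1" and \<kappa>_bounds: "0 < \<kappa>" "\<kappa> \<le> (\<eta> / 500)\<^sup>2"
    and m_large: "12 \<le> \<kappa> * m"
    and A_sumset: "finite A" "card (A + A) \<le> m" and g_le: "g \<le> \<eta> * s"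
    and B_large_container: "has_container \<tau> g (nat \<lfloor>\<kappa> * m\<rfloor>) A B" "(1 - 3 * \<kappa>) * m / 2 \<le> card B"
  shows "A \<in> near_progression \<eta> s m"
proof -
  obtain D where D: "finite B" "finite D" "card D \<le> card (A + A)"
    and missing: "\<And>x. x \<in> B \<Longrightarrow> card {y \<in> B. x + y \<notin> D} \<le> nat \<lfloor>\<kappa> * m\<rfloor>"
    using has_container_almost_closed[OF B_large_container(1) A_sumset(1)] by blast
  have "card {y \<in> B. x + y \<notin> D} \<le> \<kappa> * m" if "x \<in> B" for x
    using missing[OF that] \<kappa>_bounds(1) by (simp add: le_nat_iff le_floor_iff)
  moreover have "card D \<le> m" using D(3) A_sumset(2) by linarith
  ultimately obtain P where P: "arith_prog P" "B \<subseteq> P" "card P \<le> m / 2 + \<eta> * m"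
    using large_almost_closed_subset_arith_prog[OF \<eta>_bounds \<kappa>_bounds m_large D(1,2)]
      B_large_container(2)
    by blast
  have "real (card (A - P)) \<le> \<eta> * s"
    using card_Diff_has_container_le[OF B_large_container(1) A_sumset(1) P(2)] g_le by linarith
  with P(1,3) show ?thesis unfolding near_progression_def by blast
qed

lemma card_far_from_progression_le:
  fixes \<eta> \<kappa> :: real
  assumes "0 < \<eta>" "\<eta> \<le> 1" "0 < \<kappa>" "\<kappa> \<le> (\<eta> / 500)\<^sup>2" "12 \<le> \<kappa> * m" "g \<le> \<eta> * s"
    and container: "\<And>A. A \<in> small_doubling n s m \<Longrightarrow> \<exists>B. has_container \<tau> g (nat \<lfloor>\<kappa> * m\<rfloor>) A B"
    and b_large: "(1 - 3 * \<kappa>) * m / 2 \<le> real b + 1"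
  shows "card (small_doubling n s m - near_progression \<eta> s m)
    \<le> (n + 1) ^ (3 * \<tau>) * (\<Sum>y\<le>g. 2 ^ y * ((2 * m choose y) * (b choose (s - y))))"
proof -
  have "A \<subseteq> {1..int n} \<and> card A = s \<and> card (A + A) \<le> m \<and>
      (\<exists>B. has_container \<tau> g (nat \<lfloor>\<kappa> * m\<rfloor>) A B \<and> card B \<le> b)"
    if A_far: "A \<in> small_doubling n s m - near_progression \<eta> s m" for A
  proof -
    have A_small_doubling: "A \<subseteq> {1..int n}" "card A = s" "card (A + A) \<le> m"
      using A_far by (simp_all add: small_doubling_def)
    then have "finite A" using finite_subset by blast
    obtain B where B_container: "has_container \<tau> g (nat \<lfloor>\<kappa> * m\<rfloor>) A B" using container A_far by blast
    have "card B \<le> b"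
    proof (rule ccontr)
      assume "\<not> ?thesis"
      then have "(1 - 3 * \<kappa>) * m / 2 \<le> card B" using b_large by linarith
      with A_far show False
        using has_large_container_near_progression[OF assms(1-5) \<open>finite A\<close>
            A_small_doubling(3) assms(6) B_container] by blast
    qed
    with A_small_doubling B_container show ?thesis by blast
  qed
  then have "card (small_doubling n s m - near_progression \<eta> s m)
    \<le> (card {1..int n} + 1) ^ (3 * \<tau>) * (\<Sum>y\<le>g. 2 ^ y * ((2 * m choose y) * (b choose (s - y))))"
    by (intro card_has_small_container_le[where e = "nat \<lfloor>\<kappa> * m\<rfloor>"]) simp_all
  then show ?thesis by simp
qed

lemma encoding_count_le:
  fixes \<kappa> :: real and b g k m n s \<tau> :: nat
  assumes \<kappa>_bounds: "0 < \<kappa>" "\<kappa> \<le> 1 / 9" and n_ge_2: "2 \<le> n" and s_bounds: "0 < s" "s \<le> m"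
    and m_le: "m * (log 2 n)\<^sup>2 \<le> (\<kappa> / 200)\<^sup>2 * (real s)\<^sup>2"
    and \<tau>_le: "\<tau> \<le> 2 * (sqrt m + 1) + 4 / \<kappa> + 1"
    and k_bounds: "m \<le> 2 * k" "1 \<le> \<kappa> * k" and b_le: "b \<le> (1 - 3 * \<kappa>) * k"
    and g_le: "g \<le> (\<kappa> / 16)\<^sup>2 * s"
  shows "real ((n + 1) ^ (3 * \<tau>) * (\<Sum>y\<le>g. 2 ^ y * ((2 * m choose y) * (b choose (s - y)))))
    \<le> exp (- (\<kappa> * s / 2)) * real (k choose s)"
proof -
  have "real ((n + 1) ^ (3 * \<tau>) * (\<Sum>y\<le>g. 2 ^ y * ((2 * m choose y) * (b choose (s - y)))))
      = (real n + 1) ^ (3 * \<tau>) * (\<Sum>y\<le>g. 2 ^ y * (real (2 * m choose y) * real (b choose (s - y))))"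
    by (simp add: add.commute)
  also have "\<dots> \<le> exp (\<kappa> * s / 8) * (exp (- (3 / 4 * (\<kappa> * s))) * real (k choose s))"
  proof (rule mult_mono)
    have "6 * (\<tau> * log 2 n) \<le> \<kappa> * s / 8"
      by (rule seed_cost_le[of \<kappa> _ s m]) (use \<kappa>_bounds n_ge_2 s_bounds m_le \<tau>_le in auto)
    with power_le_exp_log[OF n_ge_2, of \<tau>] show "(real n + 1) ^ (3 * \<tau>) \<le> exp (\<kappa> * s / 8)"
      by (meson exp_le_cancel_iff order_trans)
    show "(\<Sum>y\<le>g. 2 ^ y * (real (2 * m choose y) * real (b choose (s - y))))
        \<le> exp (- (3 / 4 * (\<kappa> * s))) * real (k choose s)"
      using \<kappa>_bounds k_bounds s_bounds(2) b_le g_le by (intro sum_container_weight_le) auto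
  qed (auto intro: sum_nonneg)
  also have "\<dots> = exp (\<kappa> * s / 8 - 3 / 4 * (\<kappa> * s)) * real (k choose s)"
    by (simp add: mult.assoc[symmetric] flip: exp_add)
  also have "\<dots> \<le> exp (- (\<kappa> * s / 2)) * real (k choose s)"
    using \<kappa>_bounds by (intro mult_right_mono) (auto simp: field_simps)
  finally show ?thesis .
qed

lemma card_far_from_progression_le_exp:
  fixes \<eta> \<kappa> :: real
  assumes \<eta>_bounds: "0 < \<eta>" "\<eta> \<le> 1" and \<kappa>_bounds: "0 < \<kappa>" "\<kappa> \<le> (\<eta> / 500)\<^sup>2" "12 \<le> \<kappa> * m"
    and n_bounds: "2 \<le> n" "m \<le> 2 * n" and s_bounds: "0 < s" "s \<le> m"
    and m_le: "m * (log 2 n)\<^sup>2 \<le> (\<kappa> / 200)\<^sup>2 * (real s)\<^sup>2"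
    and \<tau>_le: "\<tau> \<le> 2 * (sqrt m + 1) + 4 / \<kappa> + 1" and g_le: "g \<le> \<eta> * s" "g \<le> (\<kappa> / 16)\<^sup>2 * s"
    and container: "\<And>A. A \<in> small_doubling n s m \<Longrightarrow> \<exists>B. has_container \<tau> g (nat \<lfloor>\<kappa> * m\<rfloor>) A B"
  shows "card (small_doubling n s m - near_progression \<eta> s m)
    \<le> exp (- (\<kappa> * s / 2)) * card (small_doubling n s m)"
proof -
  define k where "k = (m + 1) div 2"
  define b where "b = nat \<lfloor>(1 - 3 * \<kappa>) * k\<rfloor>"
  have k_bounds: "m \<le> 2 * k" "2 * k \<le> m + 1" "k \<le> n" using n_bounds(2) by (auto simp: k_def)
  have "\<eta>\<^sup>2 \<le> 1" using \<eta>_bounds by (simp add: power_le_one)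
  then have "\<kappa> \<le> 1 / 9" using \<kappa>_bounds(2) by (simp add: power_divide)
  then have b_bounds: "b \<le> (1 - 3 * \<kappa>) * k" "(1 - 3 * \<kappa>) * k \<le> real b + 1"
    unfolding b_def by (simp, linarith)
  have "\<kappa> * m \<le> \<kappa> * (2 * k)" using \<kappa>_bounds(1) k_bounds(1) by (intro mult_left_mono) auto
  then have "1 \<le> \<kappa> * k" using \<kappa>_bounds(3) by simp
  have "(1 - 3 * \<kappa>) * (m / 2) \<le> (1 - 3 * \<kappa>) * k"
    using k_bounds(1) \<open>\<kappa> \<le> 1 / 9\<close> by (intro mult_left_mono) auto
  then have "card (small_doubling n s m - near_progression \<eta> s m)
      \<le> (n + 1) ^ (3 * \<tau>) * (\<Sum>y\<le>g. 2 ^ y * ((2 * m choose y) * (b choose (s - y))))"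
    using b_bounds(2)
    by (intro card_far_from_progression_le[OF \<eta>_bounds \<kappa>_bounds g_le(1) container]) auto
  then have "real (card (small_doubling n s m - near_progression \<eta> s m))
      \<le> real ((n + 1) ^ (3 * \<tau>) * (\<Sum>y\<le>g. 2 ^ y * ((2 * m choose y) * (b choose (s - y)))))"
    by (rule of_nat_mono)
  also have "\<dots> \<le> exp (- (\<kappa> * s / 2)) * real (k choose s)"
    by (rule encoding_count_le[OF \<kappa>_bounds(1) \<open>\<kappa> \<le> 1 / 9\<close> n_bounds(1) s_bounds m_le \<tau>_le k_bounds(1)
          \<open>1 \<le> \<kappa> * k\<close> b_bounds(1) g_le(2)])
  also have "\<dots> \<le> exp (- (\<kappa> * s / 2)) * card (small_doubling n s m)"
    using k_bounds(2,3) by (intro mult_left_mono of_nat_mono binomial_le_card_small_doubling) auto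
  finally show ?thesis .
qed

lemma mult_ge_12_and_exp_neg_le:
  fixes \<eta> \<kappa> s :: real
  assumes "0 < \<kappa>" "\<kappa> \<le> \<eta>" "\<eta> \<le> 1" "0 \<le> s" "1 \<le> (\<kappa> / 200)\<^sup>2 * s"
  shows "12 \<le> \<kappa> * s" "exp (- (\<kappa> * s / 2)) \<le> \<eta>"
proof -
  have "40000 \<le> \<kappa> * (\<kappa> * s)" using assms(5) by (simp add: power2_eq_square)
  also have "\<kappa> * (\<kappa> * s) \<le> \<eta> * (\<kappa> * s)" using assms by (intro mult_right_mono) auto
  finally have \<eta>_s: "40000 \<le> \<eta> * (\<kappa> * s)" .
  also have "\<eta> * (\<kappa> * s) \<le> 1 * (\<kappa> * s)" using assms by (intro mult_right_mono) auto
  finally show "12 \<le> \<kappa> * s" by simp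
  have "1 / \<eta> \<le> \<kappa> * s / 2" using \<eta>_s assms(1,2) by (simp add: field_simps)
  also have "\<dots> \<le> exp (\<kappa> * s / 2)" using exp_ge_add_one_self[of "\<kappa> * s / 2"] by linarith
  finally show "exp (- (\<kappa> * s / 2)) \<le> \<eta>" using assms(1,2) by (simp add: exp_minus field_simps)
qed

lemma card_far_from_progression_le_mult:
  fixes \<eta> \<kappa> :: real
  assumes \<eta>_bounds: "0 < \<eta>" "\<eta> \<le> 1" and \<kappa>_bounds: "0 < \<kappa>" "\<kappa> \<le> (\<eta> / 500)\<^sup>2"
    and n_bounds: "2 \<le> n" "m \<le> 2 * n" and s_bounds: "0 < s" "s \<le> m"
    and m_le: "m * (log 2 n)\<^sup>2 \<le> (\<kappa> / 200)\<^sup>2 * (real s)\<^sup>2"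
    and \<tau>_le: "\<tau> \<le> 2 * (sqrt m + 1) + 4 / \<kappa> + 1"
    and container: "\<And>A. A \<in> small_doubling n s m \<Longrightarrow>
      \<exists>B. has_container \<tau> (nat \<lfloor>(\<kappa> / 16)\<^sup>2 * s\<rfloor>) (nat \<lfloor>\<kappa> * m\<rfloor>) A B"
  shows "card (small_doubling n s m - near_progression \<eta> s m) \<le> \<eta> * card (small_doubling n s m)"
proof -
  have "\<eta>\<^sup>2 \<le> \<eta>" using \<eta>_bounds power2_le_mult[of \<eta> 1] by simp
  then have "\<kappa> \<le> \<eta>" using \<kappa>_bounds(2) \<eta>_bounds(1) by (simp add: power_divide)
  have "\<kappa>\<^sup>2 \<le> \<kappa>"
    using \<kappa>_bounds(1) \<open>\<kappa> \<le> \<eta>\<close> \<eta>_bounds(2) power2_le_mult[of \<kappa> 1] by simp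
  then have "(\<kappa> / 16)\<^sup>2 \<le> \<eta>" using \<open>\<kappa> \<le> \<eta>\<close> \<eta>_bounds(1) by (simp add: power_divide)
  have log_ge_1: "1 \<le> log 2 n" using n_bounds(1) by simp
  have "log 2 n \<le> (\<kappa> / 200)\<^sup>2 * s"
    by (rule le_mult_of_mult_square_le[OF log_ge_1 _ _ m_le]) (use s_bounds in auto)
  with log_ge_1 have "1 \<le> (\<kappa> / 200)\<^sup>2 * s" by linarith
  then have scale_bounds: "12 \<le> \<kappa> * s" "exp (- (\<kappa> * s / 2)) \<le> \<eta>"
    using mult_ge_12_and_exp_neg_le[OF \<kappa>_bounds(1) \<open>\<kappa> \<le> \<eta>\<close> \<eta>_bounds(2), of s] by simp_all
  have "\<kappa> * s \<le> \<kappa> * m" using s_bounds(2) \<kappa>_bounds(1) by (intro mult_left_mono) auto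
  with scale_bounds(1) have "12 \<le> \<kappa> * m" by linarith
  have "card (small_doubling n s m - near_progression \<eta> s m)
      \<le> exp (- (\<kappa> * s / 2)) * card (small_doubling n s m)"
  proof (rule card_far_from_progression_le_exp[OF \<eta>_bounds \<kappa>_bounds \<open>12 \<le> \<kappa> * m\<close>
          n_bounds s_bounds m_le \<tau>_le _ _ container])
    show "nat \<lfloor>(\<kappa> / 16)\<^sup>2 * s\<rfloor> \<le> (\<kappa> / 16)\<^sup>2 * s" by simp
    also have "\<dots> \<le> \<eta> * s" using \<open>(\<kappa> / 16)\<^sup>2 \<le> \<eta>\<close> by (rule mult_right_mono) simp
    finally show "nat \<lfloor>(\<kappa> / 16)\<^sup>2 * s\<rfloor> \<le> \<eta> * s" .
  qed
  also have "\<dots> \<le> \<eta> * card (small_doubling n s m)"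
    using scale_bounds(2) by (rule mult_right_mono) simp
  finally show ?thesis .
qed

lemma obtain_few_far_from_progression:
  fixes \<eta> :: real
  assumes \<eta>_bounds: "0 < \<eta>" "\<eta> \<le> 1"
  obtains c :: real where "0 < c"
    "\<And>n s m. \<lbrakk>2 \<le> n; 0 < s; m * (log 2 n)\<^sup>2 \<le> c * (real s)\<^sup>2\<rbrakk>
      \<Longrightarrow> card (small_doubling n s m - near_progression \<eta> s m) \<le> \<eta> * card (small_doubling n s m)"
proof -
  define \<kappa> where "\<kappa> = (\<eta> / 500)\<^sup>2"
  have \<kappa>_bounds: "0 < \<kappa>" "\<kappa> \<le> (\<eta> / 500)\<^sup>2" using \<eta>_bounds by (simp_all add: \<kappa>_def)
  then have "0 < (\<kappa> / 16)\<^sup>2" by simp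
  then obtain c\<^sub>0 :: real where "0 < c\<^sub>0" and container:
    "\<And>(A :: int set) m \<tau>.
      \<lbrakk>finite A; A \<noteq> {}; card (A + A) \<le> m; m \<le> c\<^sub>0 * (card A)\<^sup>2; 2 * (sqrt m + 1) + 4 / \<kappa> \<le> \<tau>\<rbrakk>
      \<Longrightarrow> \<exists>B. has_container \<tau> (nat \<lfloor>(\<kappa> / 16)\<^sup>2 * card A\<rfloor>) (nat \<lfloor>\<kappa> * m\<rfloor>) A B"
    by (rule obtain_container_const[OF _ \<kappa>_bounds(1)]) blast
  define c where "c = min c\<^sub>0 ((\<kappa> / 200)\<^sup>2)"
  have c_bounds: "0 < c" "c \<le> c\<^sub>0" "c \<le> (\<kappa> / 200)\<^sup>2"
    using \<kappa>_bounds(1) \<open>0 < c\<^sub>0\<close> by (simp_all add: c_def)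
  have "card (small_doubling n s m - near_progression \<eta> s m) \<le> \<eta> * card (small_doubling n s m)"
    if n_ge_2: "2 \<le> n" and s_pos: "0 < s" and m_le: "m * (log 2 n)\<^sup>2 \<le> c * (real s)\<^sup>2" for n s m
  proof (cases "small_doubling n s m = {} \<or> 2 * n \<le> m")
    case True
    then have "small_doubling n s m - near_progression \<eta> s m = {}"
      using small_doubling_subset_near_progression[of n m \<eta> s] n_ge_2 \<eta>_bounds by auto
    then show ?thesis using \<eta>_bounds by (simp only: card.empty) simp
  next
    case False
    then have m_bounds: "s \<le> m" "m \<le> 2 * n" using small_doubling_imp_le by auto
    define \<tau> where "\<tau> = nat \<lceil>2 * (sqrt m + 1) + 4 / \<kappa>\<rceil>"
    have "0 \<le> 2 * (sqrt m + 1) + 4 / \<kappa>" using \<kappa>_bounds(1) by simp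
    then have \<tau>_bounds: "2 * (sqrt m + 1) + 4 / \<kappa> \<le> \<tau>" "\<tau> \<le> 2 * (sqrt m + 1) + 4 / \<kappa> + 1"
      unfolding \<tau>_def by linarith+
    have "real m * 1 \<le> m * (log 2 n)\<^sup>2"
      using n_ge_2 by (intro mult_left_mono) (simp_all add: one_le_power)
    then have m_le_square: "m \<le> c\<^sub>0 * (real s)\<^sup>2"
      using m_le mult_right_mono[OF c_bounds(2), of "(real s)\<^sup>2"] by simp
    show ?thesis
    proof (rule card_far_from_progression_le_mult[OF \<eta>_bounds \<kappa>_bounds n_ge_2 m_bounds(2) s_pos
          m_bounds(1) _ \<tau>_bounds(2)])
      show "m * (log 2 n)\<^sup>2 \<le> (\<kappa> / 200)\<^sup>2 * (real s)\<^sup>2"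
        using m_le mult_right_mono[OF c_bounds(3), of "(real s)\<^sup>2"] by simp
      show "\<exists>B. has_container \<tau> (nat \<lfloor>(\<kappa> / 16)\<^sup>2 * s\<rfloor>) (nat \<lfloor>\<kappa> * m\<rfloor>) A B"
        if "A \<in> small_doubling n s m" for A
        using container[of A m \<tau>] that s_pos \<tau>_bounds(1) m_le_square
          finite_subset[of A "{1..int n}"]
        by (auto simp: small_doubling_def card_gt_0_iff)
    qed
  qed
  with c_bounds(1) show thesis by (rule that)
qed

lemma prob_pmf_of_set_ge:
  fixes \<A> \<B> :: "'a set" and \<epsilon> :: real
  assumes "finite \<A>" "\<A> \<noteq> {}" "card (\<A> - \<B>) \<le> \<epsilon> * card \<A>"
  shows "1 - \<epsilon> \<le> measure_pmf.prob (pmf_of_set \<A>) \<B>"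
proof -
  have "card \<A> = card (\<A> \<inter> \<B>) + card (\<A> - \<B>)"
    using assms(1) by (metis Int_Diff_Un Int_Diff_disjoint card_Un_disjoint finite_Diff finite_Int)
  then have "(1 - \<epsilon>) * card \<A> \<le> card (\<A> \<inter> \<B>)" using assms(3) by (simp add: algebra_simps)
  moreover have "0 < card \<A>" using assms(1,2) by (simp add: card_gt_0_iff)
  ultimately show ?thesis
    unfolding measure_pmf_of_set[OF assms(2,1)] by (simp add: pos_le_divide_eq)
qed

lemma eventually_prob_near_progression_ge:
  fixes m s :: "nat \<Rightarrow> nat"
  assumes "\<And>n. 1 \<le> n \<Longrightarrow> 0 < s n"
    and "(\<lambda>n. real (m n)) \<in> o(\<lambda>n. (real (s n))\<^sup>2 / (log 2 (real n))\<^sup>2)"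
    and \<eta>_bounds: "0 < \<eta>" "\<eta> \<le> 1"
  shows "\<forall>\<^sub>F n in sequentially. small_doubling n (s n) (m n) \<noteq> {} \<longrightarrow>
    1 - \<eta> \<le> measure_pmf.prob (pmf_of_set (small_doubling n (s n) (m n)))
      (near_progression \<eta> (s n) (m n))"
proof -
  obtain c :: real where "0 < c" and few_far:
    "\<And>n s m. \<lbrakk>2 \<le> n; 0 < s; m * (log 2 n)\<^sup>2 \<le> c * (real s)\<^sup>2\<rbrakk>
      \<Longrightarrow> card (small_doubling n s m - near_progression \<eta> s m) \<le> \<eta> * card (small_doubling n s m)"
    by (rule obtain_few_far_from_progression[OF \<eta>_bounds]) blast
  have "\<forall>\<^sub>F n in sequentially. norm (real (m n)) \<le> c * norm ((real (s n))\<^sup>2 / (log 2 (real n))\<^sup>2)"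
    using landau_o.smallD[OF assms(2) \<open>0 < c\<close>] .
  then show ?thesis
    using eventually_ge_at_top[of 2]
  proof eventually_elim
    case (elim n)
    then have "0 < log 2 (real n)" by simp
    then have "0 < (log 2 (real n))\<^sup>2" by simp
    with elim(1) have "m n * (log 2 n)\<^sup>2 \<le> c * (real (s n))\<^sup>2" by (simp add: field_simps)
    then show ?case
      using few_far[of n "s n" "m n"] elim(2) assms(1)[of n] finite_small_doubling
      by (auto intro!: prob_pmf_of_set_ge)
  qed
qed

lemma obtain_eventually_diagonal:
  fixes Q :: "nat \<Rightarrow> nat \<Rightarrow> bool"
  assumes "\<And>j. eventually (Q j) sequentially"
  obtains f where "filterlim f at_top sequentially" "\<forall>\<^sub>F n in sequentially. Q (f n) n"
proof -
  define J where "J n = {j \<in> {..n}. Q j n}" for n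
  have fin: "finite (J n)" for n by (simp add: J_def)
  have J: "\<forall>\<^sub>F n in sequentially. j \<in> J n" for j
    using assms[of j] eventually_ge_at_top[of j] by eventually_elim (simp add: J_def)
  show thesis
  proof (rule that[of "\<lambda>n. Max (J n)"])
    show "filterlim (\<lambda>n. Max (J n)) at_top sequentially"
      unfolding filterlim_at_top
    proof
      fix j show "\<forall>\<^sub>F n in sequentially. j \<le> Max (J n)"
        using J[of j] by eventually_elim (simp add: fin)
    qed
    show "\<forall>\<^sub>F n in sequentially. Q (Max (J n)) n"
      using J[of 0]
    proof eventually_elim
      case (elim n)
      then have "Max (J n) \<in> J n" using fin by (intro Max_in) auto
      then show ?case by (simp add: J_def)
    qed
  qed
qed

theorem theorem1p3:
  fixes m s :: "nat \<Rightarrow> nat"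
  assumes "\<And>n. 1 \<le> n \<Longrightarrow> 0 < m n"
    and "\<And>n. 1 \<le> n \<Longrightarrow> 0 < s n"
    and "(\<lambda>n. real (m n)) \<in> o(\<lambda>n. (real (s n))\<^sup>2 / (log 2 (real n))\<^sup>2)"
  shows "\<exists>\<eta> :: nat \<Rightarrow> real. \<eta> \<longlonglongrightarrow> 0 \<and>
    ((\<lambda>n. measure_pmf.prob (pmf_of_set (small_doubling n (s n) (m n)))
            {A. \<exists>P. arith_prog P \<and>
                    real (card P) \<le> real (m n) / 2 + \<eta> n * real (m n) \<and>
                    real (card (A - P)) \<le> \<eta> n * real (s n)})
      \<longlongrightarrow> 1) (inf sequentially (principal {n. small_doubling n (s n) (m n) \<noteq> {}}))"
proof -
  let ?F = "inf sequentially (principal {n. small_doubling n (s n) (m n) \<noteq> {}})"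
  define p where "p \<eta> n = measure_pmf.prob (pmf_of_set (small_doubling n (s n) (m n)))
    (near_progression \<eta> (s n) (m n))" for \<eta> n
  have "\<forall>\<^sub>F n in sequentially. small_doubling n (s n) (m n) \<noteq> {} \<longrightarrow>
      1 - 1 / Suc j \<le> p (1 / Suc j) n" for j
    unfolding p_def by (rule eventually_prob_near_progression_ge[OF assms(2,3)]) simp_all
  then obtain j where j_diagonal: "filterlim j at_top sequentially"
    "\<forall>\<^sub>F n in sequentially. small_doubling n (s n) (m n) \<noteq> {} \<longrightarrow>
      1 - 1 / Suc (j n) \<le> p (1 / Suc (j n)) n"
    by (rule obtain_eventually_diagonal)
  define \<eta> where "\<eta> n = 1 / real (Suc (j n))" for n
  have "(\<lambda>j. 1 / real (Suc j)) \<longlonglongrightarrow> 0" using LIMSEQ_Suc[OF lim_1_over_n] .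
  then have \<eta>_tendsto: "\<eta> \<longlonglongrightarrow> 0" unfolding \<eta>_def using j_diagonal(1) by (rule filterlim_compose)
  have "((\<lambda>n. p (\<eta> n) n) \<longlongrightarrow> 1) ?F"
  proof (rule tendsto_sandwich)
    show "\<forall>\<^sub>F n in ?F. 1 - \<eta> n \<le> p (\<eta> n) n"
      using j_diagonal(2) by (simp add: eventually_inf_principal \<eta>_def)
    show "\<forall>\<^sub>F n in ?F. p (\<eta> n) n \<le> 1" by (simp add: p_def)
    have "(\<lambda>n. 1 - \<eta> n) \<longlonglongrightarrow> 1" using tendsto_diff[OF tendsto_const \<eta>_tendsto, of 1] by simp
    then show "((\<lambda>n. 1 - \<eta> n) \<longlongrightarrow> 1) ?F" by (rule tendsto_mono[OF inf_le1])
  qed (rule tendsto_const)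
  with \<eta>_tendsto show ?thesis unfolding p_def near_progression_def by blast
qed

end
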